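(* Let $f$ be an invertible polynomial in $n$ variables which is invariant with respect to a subgroup $S$ of the group $S_n$ of permutations of the variables, let $G$ be a subgroup of $G_f$ preserved by $S$, and let $T$ be a subgroup of $S$. Then $$\chi^{\rm orb}\bigl(G_f\rtimes S/\{e\}\rtimes T,\; G\rtimes S\bigr)=\chi^{\rm orb}\bigl(G_{\widetilde f}\rtimes S/G_{\widetilde f}\rtimes T,\; \widetilde G\rtimes S\bigr).$$ Here $G_f\rtimes S/\{e\}\rtimes T$ is the set of left cosets of $\{e\}\rtimes T$ in $G_f\rtimes S$, with $G\rtimes S\subset G_f\rtimes S$ acting by left multiplication, and $G_{\widetilde f}\rtimes S/G_{\widetilde f}\rtimes T$ is the set of left cosets of $G_{\widetilde f}\rtimes T$ in $G_{\widetilde f}\rtimes S$, with $\widetilde G\rtimes S\subset G_{\widetilde f}\rtimes S$ acting by left multiplication.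
   Context: An invertible polynomial in $n$ variables is a quasihomogeneous polynomial $f(x_1,\ldots,x_n)=\sum_{i=1}^n a_i\prod_{j=1}^n x_j^{E_{ij}}$ with $a_i\in\mathbb{C}\setminus\{0\}$ and $E_{ij}$ non-negative integers, such that the matrix $E=(E_{ij})$ is non-degenerate and $f$ has an isolated critical point at the origin. The group of diagonal symmetries of $f$ is $G_f=\{(\lambda_1,\ldots,\lambda_n)\in(\mathbb{C}^* )^n: f(\lambda_1x_1,\ldots,\lambda_nx_n)=f(x_1,\ldots,x_n)\}$, a finite abelian group of order $|\det E|$ with unit $e$. The Berglund–Hübsch transpose is $\widetilde f(x_1,\ldots,x_n)=\sum_{i=1}^n\prod_{j=1}^n x_j^{E_{ji}}$, and $G_{\widetilde f}$ is its group of diagonal symmetries. $G_{\widetilde f}$ is canonically isomorphic to, and identified with, the group of characters $G_f^*={\rm Hom}(G_f,\mathbb{C}^* )$: if $\lambda=(e^{2\pi i a_1},\ldots,e^{2\pi i a_n})\in G_f$ and $\mu=(e^{2\pi i b_1},\ldots,e^{2\pi i b_n})\in G_{\widetilde f}$, the pairing is $\langle\mu,\lambda\rangle=\exp(2\pi i\, b^{T}Ea)$. For a subgroup $G\subset G_f$, the dual subgroup is $\widetilde G=\{\alpha\in G_f^*=G_{\widetilde f}: \alpha(g)=1 \text{ for all } g\in G\}$. The group $S_n$ acts on $\mathbb{C}^n$ by permuting the variables. If $f$ is invariant with respect to $S\subset S_n$, then $S$ acts on $G_f$ by automorphisms (permuting the components); this defines $G_f\rtimes S$, and, for $G$ preserved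 by $S$, also $G\rtimes S$. The group $S$ acts on $G_{\widetilde f}=G_f^*$ by the dual action $\langle\sigma\alpha,g\rangle=\langle\alpha,\sigma^{-1}(g)\rangle$, and $\widetilde G$ is preserved by $S$; this defines $G_{\widetilde f}\rtimes S$ and $\widetilde G\rtimes S$. For $T\subset S$, the subgroups $\{e\}\rtimes T\subset G_f\rtimes S$ and $G_{\widetilde f}\rtimes T\subset G_{\widetilde f}\rtimes S$ are the natural ones. For a finite group $H$ acting on a space $X$, the orbifold Euler characteristic is $\chi^{\rm orb}(X,H)=\frac{1}{|H|}\sum_{(g,h)\in H^2:\,gh=hg}\chi(X^{\langle g,h\rangle})$, where $\langle g,h\rangle$ is the subgroup generated by $g$ and $h$ and $X^K$ is the set of points of $X$ fixed by all elements of $K$. For a finite set $X$ (as here), $\chi(X^K)=|X^K|$. *)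

theory Defs
  imports
    "HOL-Analysis.Analysis"
    "HOL-Algebra.Bij"
    "HOL-Algebra.Left_Coset"
    "HOL-Algebra.Generated_Groups"
begin

text \<open>
  Variables are indexed by a finite type \<open>'n\<close>. An invertible polynomial is given by its
  coefficients \<open>a\<close> and its exponent matrix \<open>E\<close>: row \<open>i\<close> holds the exponents of
  the \<open>i\<close>-th monomial. On vectors, \<open>*\<close> and \<open>1\<close> are the library's
  componentwise product and all-ones vector.
\<close>

definition monomial_sum :: "complex^'n \<Rightarrow> nat^'n^'n \<Rightarrow> complex^'n \<Rightarrow> complex" where
  "monomial_sum a E x = (\<Sum>i\<in>UNIV. a $ i * (\<Prod>j\<in>UNIV. x $ j ^ (E $ i $ j)))"

definition quasihomogeneous :: "(complex^'n \<Rightarrow> complex) \<Rightarrow> bool" where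
  "quasihomogeneous f \<longleftrightarrow>
     (\<exists>(w :: nat^'n) d. (\<forall>j. w $ j > 0) \<and> d > 0 \<and>
        (\<forall>(c :: complex) x. f ((\<chi> j. c ^ (w $ j)) * x) = c ^ d * f x))"

text \<open>
  For polynomial maps, the real derivative at a point vanishes iff all complex partial
  derivatives vanish there.
\<close>

definition critical_points :: "(complex^'n \<Rightarrow> complex) \<Rightarrow> (complex^'n) set" where
  "critical_points f = {x. (f has_derivative (\<lambda>_. 0)) (at x)}"

definition invertible_poly :: "complex^'n \<Rightarrow> nat^'n^'n \<Rightarrow> bool" where
  "invertible_poly a E \<longleftrightarrow>
     (\<forall>i. a $ i \<noteq> 0) \<and>
     det (\<chi> i j. int (E $ i $ j)) \<noteq> 0 \<and>
     quasihomogeneous (monomial_sum a E) \<and>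
     0 isolated_in critical_points (monomial_sum a E)"

definition diag_sym :: "(complex^'n \<Rightarrow> complex) \<Rightarrow> (complex^'n) monoid" where
  "diag_sym f =
     \<lparr>carrier = {l. (\<forall>j. l $ j \<noteq> 0) \<and> (\<forall>x. f (l * x) = f x)}, mult = (*), one = 1\<rparr>"

definition bh_transpose :: "nat^'n^'n \<Rightarrow> complex^'n \<Rightarrow> complex" where
  "bh_transpose E = monomial_sum 1 (transpose E)"

text \<open>
  For a diagonal symmetry \<open>l\<close>, whose entries are roots of unity, \<open>log_vec l\<close> is a real
  vector \<open>v\<close> with \<open>l $ j = exp (2 * pi * \<i> * v $ j)\<close>; only its class modulo integer vectors
  is canonical. The pairing below of a symmetry of the polynomial with exponent matrix \<open>E\<close>
  and a symmetry of its transpose does not depend on the representatives: for both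
  symmetries the logarithms \<open>v\<close>, \<open>u\<close> make \<open>E v\<close> and \<open>E\<^sup>T u\<close> integral.
\<close>

definition log_vec :: "complex^'n \<Rightarrow> real^'n" where
  "log_vec l = (\<chi> j. Arg (l $ j) / (2 * pi))"

definition pairing :: "nat^'n^'n \<Rightarrow> complex^'n \<Rightarrow> complex^'n \<Rightarrow> complex" where
  "pairing E m l =
     exp (2 * of_real pi * \<i> *
       of_real (log_vec m \<bullet> ((\<chi> i j. real (E $ i $ j)) *v log_vec l)))"

definition dual_subgroup :: "nat^'n^'n \<Rightarrow> (complex^'n) set \<Rightarrow> (complex^'n) set" where
  "dual_subgroup E G =
     {m \<in> carrier (diag_sym (bh_transpose E)). \<forall>g\<in>G. pairing E m g = 1}"

definition perm_act :: "('n \<Rightarrow> 'n) \<Rightarrow> complex^'n \<Rightarrow> complex^'n" where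
  "perm_act s x = (\<chi> j. x $ (inv_into UNIV s j))"

text \<open>
  The action on the symmetries of the transpose is the one dual to \<open>perm_act\<close>. In general
  it is not \<open>perm_act s\<close>, because \<open>s\<close> also permutes the monomials. Existence and uniqueness
  of the described element come from the perfectness of the pairing when \<open>E\<close> is
  non-degenerate and \<open>monomial_sum a E\<close> is invariant under \<open>s\<close>.
\<close>

definition dual_act ::
  "complex^'n \<Rightarrow> nat^'n^'n \<Rightarrow> ('n \<Rightarrow> 'n) \<Rightarrow> complex^'n \<Rightarrow> complex^'n" where
  "dual_act a E s m =
     (THE m'. m' \<in> carrier (diag_sym (bh_transpose E)) \<and>
        (\<forall>g\<in>carrier (diag_sym (monomial_sum a E)).
           pairing E m' g = pairing E m (perm_act (inv_into UNIV s) g)))"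

definition semidirect ::
  "('a, 'c) monoid_scheme \<Rightarrow> ('b, 'd) monoid_scheme \<Rightarrow> ('b \<Rightarrow> 'a \<Rightarrow> 'a) \<Rightarrow> ('a \<times> 'b) monoid" where
  "semidirect N H \<phi> =
     \<lparr>carrier = carrier N \<times> carrier H,
      mult = (\<lambda>(n, h) (n', h'). (n \<otimes>\<^bsub>N\<^esub> \<phi> h n', h \<otimes>\<^bsub>H\<^esub> h')),
      one = (\<one>\<^bsub>N\<^esub>, \<one>\<^bsub>H\<^esub>)\<rparr>"

text \<open>
  The orbifold Euler characteristic of a finite set, so that the Euler characteristic of a
  fixed-point set is its cardinality.
\<close>

definition orbifold_euler ::
  "'x set \<Rightarrow> ('g, 'c) monoid_scheme \<Rightarrow> ('g \<Rightarrow> 'x \<Rightarrow> 'x) \<Rightarrow> real" where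
  "orbifold_euler X H \<phi> =
     1 / real (card (carrier H)) *
     (\<Sum>(g, h) \<in> {(g, h). g \<in> carrier H \<and> h \<in> carrier H \<and> g \<otimes>\<^bsub>H\<^esub> h = h \<otimes>\<^bsub>H\<^esub> g}.
        real (card {x \<in> X. \<forall>k \<in> generate H {g, h}. \<phi> k x = x}))"

definition symm_semidirect ::
  "complex^'n \<Rightarrow> nat^'n^'n \<Rightarrow> ('n \<Rightarrow> 'n) set \<Rightarrow> ((complex^'n) \<times> ('n \<Rightarrow> 'n)) monoid" where
  "symm_semidirect a E S =
     semidirect (diag_sym (monomial_sum a E)) (BijGroup UNIV\<lparr>carrier := S\<rparr>) perm_act"

definition dual_symm_semidirect ::
  "complex^'n \<Rightarrow> nat^'n^'n \<Rightarrow> ('n \<Rightarrow> 'n) set \<Rightarrow> ((complex^'n) \<times> ('n \<Rightarrow> 'n)) monoid" where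
  "dual_symm_semidirect a E S =
     semidirect (diag_sym (bh_transpose E)) (BijGroup UNIV\<lparr>carrier := S\<rparr>) (dual_act a E)"

end

theory Submission
  imports Defs
begin

text \<open>
  Write \<open>A\<close> for \<open>G\<^sub>f\<close>, \<open>B\<close> for the symmetry group of the transpose, and \<open>c h k\<close> for the number
  of cosets of \<open>T\<close> in \<open>S\<close> fixed by \<open>h\<close> and \<open>k\<close>. The cosets of \<open>1 \<times> T\<close> are the sets \<open>{x} \<times> D\<close> with
  \<open>x \<in> A\<close> and \<open>D\<close> a coset of \<open>T\<close>, and \<open>(g, h)\<close> fixes \<open>{x} \<times> D\<close> iff \<open>h D = D\<close> and \<open>g = x / h x\<close>.
  The cosets of \<open>B \<times> T\<close> are the sets \<open>B \<times> D\<close>, on which \<open>B\<close> acts trivially. Hence, up to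
  the factor \<open>1 / \<bar>S\<bar>\<close>, the two sides are the sums over commuting \<open>h, k \<in> S\<close> of \<open>c h k\<close> times
  \<open>\<bar>{x \<in> A. x / h x \<in> G \<and> x / k x \<in> G}\<bar> / \<bar>G\<bar>\<close>, respectively \<open>c h k\<close> times
  \<open>\<bar>{(\<alpha>, \<beta>). \<alpha> / k \<alpha> = \<beta> / h \<beta>}\<bar> / \<bar>G'\<bar>\<close> with \<open>\<alpha>, \<beta>\<close> in the dual subgroup \<open>G'\<close> of \<open>G\<close>.
  These factors agree for every \<open>h\<close> and \<open>k\<close>, by orthogonality of characters.
\<close>

section \<open>Finite abelian groups in duality\<close>

text \<open>If \<open>c y\<close> differs from 1 for some \<open>y\<close>, translation by
  \<open>y\<close> permutes the group and multiplies the sum by \<open>c y\<close>, so the sum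
  vanishes.\<close>

lemma (in group) sum_character:
  fixes c :: "'a \<Rightarrow> complex"
  assumes mult: "\<And>x y. x \<in> carrier G \<Longrightarrow> y \<in> carrier G \<Longrightarrow> c (x \<otimes> y) = c x * c y"
  shows "(\<Sum>x\<in>carrier G. c x) = (if \<forall>x\<in>carrier G. c x = 1 then of_nat (card (carrier G)) else 0)"
proof (cases "\<forall>x\<in>carrier G. c x = 1")
  case False
  then obtain y where y: "y \<in> carrier G" "c y \<noteq> 1" by blast
  have "bij_betw (\<lambda>x. y \<otimes> x) (carrier G) (carrier G)"
    using y by (simp add: bij_betw_def inj_on_cmult surj_const_mult)
  then have "(\<Sum>x\<in>carrier G. c x) = (\<Sum>x\<in>carrier G. c (y \<otimes> x))"
    by (rule sum.reindex_bij_betw[symmetric])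
  also have "\<dots> = c y * (\<Sum>x\<in>carrier G. c x)"
    using y by (simp add: mult sum_distrib_left)
  finally have "(c y - 1) * (\<Sum>x\<in>carrier G. c x) = 0"
    by (simp add: algebra_simps)
  with y False show ?thesis by auto
qed simp

section \<open>Actions by automorphisms and semidirect products\<close>

locale aut_action = N: group N + H: group H
  for N :: "('a, 'c) monoid_scheme" and H :: "('b, 'd) monoid_scheme" +
  fixes \<phi> :: "'b \<Rightarrow> 'a \<Rightarrow> 'a"
  assumes hom: "h \<in> carrier H \<Longrightarrow> \<phi> h \<in> hom N N"
    and act_mult: "\<lbrakk>h \<in> carrier H; k \<in> carrier H; x \<in> carrier N\<rbrakk> \<Longrightarrow> \<phi> (h \<otimes>\<^bsub>H\<^esub> k) x = \<phi> h (\<phi> k x)"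
    and act_one: "x \<in> carrier N \<Longrightarrow> \<phi> \<one>\<^bsub>H\<^esub> x = x"
begin

lemma act_closed [simp]: "\<lbrakk>h \<in> carrier H; x \<in> carrier N\<rbrakk> \<Longrightarrow> \<phi> h x \<in> carrier N"
  using hom by (rule hom_in_carrier)

lemma act_hom_mult [simp]:
  "\<lbrakk>h \<in> carrier H; x \<in> carrier N; y \<in> carrier N\<rbrakk> \<Longrightarrow> \<phi> h (x \<otimes>\<^bsub>N\<^esub> y) = \<phi> h x \<otimes>\<^bsub>N\<^esub> \<phi> h y"
  using hom by (rule hom_mult)

lemma act_hom_inv [simp]:
  "\<lbrakk>h \<in> carrier H; x \<in> carrier N\<rbrakk> \<Longrightarrow> \<phi> h (inv\<^bsub>N\<^esub> x) = inv\<^bsub>N\<^esub> (\<phi> h x)"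
  by (meson group_hom.hom_inv group_hom_axioms_def group_hom_def hom N.is_group)

lemma act_hom_one [simp]: "h \<in> carrier H \<Longrightarrow> \<phi> h \<one>\<^bsub>N\<^esub> = \<one>\<^bsub>N\<^esub>"
  using hom_one[OF hom N.is_group N.is_group] .

lemma act_inv_act [simp]: "\<lbrakk>h \<in> carrier H; x \<in> carrier N\<rbrakk> \<Longrightarrow> \<phi> (inv\<^bsub>H\<^esub> h) (\<phi> h x) = x"
  by (simp add: act_mult[symmetric] act_one)

lemma act_act_inv [simp]: "\<lbrakk>h \<in> carrier H; x \<in> carrier N\<rbrakk> \<Longrightarrow> \<phi> h (\<phi> (inv\<^bsub>H\<^esub> h) x) = x"
  by (simp add: act_mult[symmetric] act_one)

lemma group_semidirect: "group (semidirect N H \<phi>)"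
proof (rule groupI)
  fix x assume "x \<in> carrier (semidirect N H \<phi>)"
  then obtain n h where x: "x = (n, h)" "n \<in> carrier N" "h \<in> carrier H"
    by (auto simp: semidirect_def)
  show "\<exists>y\<in>carrier (semidirect N H \<phi>). y \<otimes>\<^bsub>semidirect N H \<phi>\<^esub> x = \<one>\<^bsub>semidirect N H \<phi>\<^esub>"
    \<comment> \<open>Only a left inverse is needed: the second component must be the inverse of
      \<open>h\<close>, and the first must cancel the image of \<open>n\<close> under it.\<close>
    by (rule bexI[of _ "(\<phi> (inv\<^bsub>H\<^esub> h) (inv\<^bsub>N\<^esub> n), inv\<^bsub>H\<^esub> h)"])
       (use x in \<open>simp_all add: semidirect_def\<close>)
qed (auto simp: semidirect_def act_mult act_one N.m_assoc H.m_assoc)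

lemma invariant_subgroup:
  assumes "subgroup L N" "\<And>h. h \<in> carrier H \<Longrightarrow> \<phi> h ` L \<subseteq> L"
  shows "aut_action (N\<lparr>carrier := L\<rparr>) H \<phi>"
proof -
  interpret L: group "N\<lparr>carrier := L\<rparr>"
    using assms(1) N.subgroup_imp_group by blast
  have sub: "L \<subseteq> carrier N" using assms(1) by (rule subgroup.subset)
  show ?thesis
  proof
    show "\<phi> h \<in> hom (N\<lparr>carrier := L\<rparr>) (N\<lparr>carrier := L\<rparr>)" if "h \<in> carrier H" for h
      using assms(2)[OF that] subsetD[OF sub] that by (intro homI) auto
  qed (use sub in \<open>simp_all add: act_mult act_one subset_iff\<close>)
qed

end

text \<open>A bilinear pairing of finite abelian groups that is nondegenerate on both sides
  identifies each of them with the character group of the other.\<close>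

locale dual_pair = A: comm_group A + B: comm_group B
  for A :: "('a, 'c) monoid_scheme" and B :: "('b, 'd) monoid_scheme" +
  fixes P :: "'b \<Rightarrow> 'a \<Rightarrow> complex"
  assumes finite_A: "finite (carrier A)" and finite_B: "finite (carrier B)"
    and P_nonzero: "\<lbrakk>m \<in> carrier B; x \<in> carrier A\<rbrakk> \<Longrightarrow> P m x \<noteq> 0"
    and P_mult_left: "\<lbrakk>m \<in> carrier B; m' \<in> carrier B; x \<in> carrier A\<rbrakk> \<Longrightarrow>
      P (m \<otimes>\<^bsub>B\<^esub> m') x = P m x * P m' x"
    and P_mult_right: "\<lbrakk>m \<in> carrier B; x \<in> carrier A; y \<in> carrier A\<rbrakk> \<Longrightarrow>
      P m (x \<otimes>\<^bsub>A\<^esub> y) = P m x * P m y"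
    and nondeg_left: "\<lbrakk>m \<in> carrier B; \<And>x. x \<in> carrier A \<Longrightarrow> P m x = 1\<rbrakk> \<Longrightarrow> m = \<one>\<^bsub>B\<^esub>"
    and nondeg_right: "\<lbrakk>x \<in> carrier A; \<And>m. m \<in> carrier B \<Longrightarrow> P m x = 1\<rbrakk> \<Longrightarrow> x = \<one>\<^bsub>A\<^esub>"
begin

text \<open>The axioms are symmetric in \<open>A\<close> and \<open>B\<close>, so each result about
  one side transfers to the other; \<open>sum_left\<close> and \<open>ann_ann\<close> rely on
  this.\<close>

lemma flip: "dual_pair B A (\<lambda>x m. P m x)"
  by unfold_locales
    (auto simp: finite_A finite_B P_nonzero P_mult_left P_mult_right nondeg_left nondeg_right)

lemma P_one_right [simp]: "m \<in> carrier B \<Longrightarrow> P m \<one>\<^bsub>A\<^esub> = 1"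
  using P_mult_right[of m "\<one>\<^bsub>A\<^esub>" "\<one>\<^bsub>A\<^esub>"] P_nonzero[of m "\<one>\<^bsub>A\<^esub>"] by simp

lemma P_one_left [simp]: "x \<in> carrier A \<Longrightarrow> P \<one>\<^bsub>B\<^esub> x = 1"
  using P_mult_left[of "\<one>\<^bsub>B\<^esub>" "\<one>\<^bsub>B\<^esub>" x] P_nonzero[of "\<one>\<^bsub>B\<^esub>" x] by simp

lemma P_inv_right: "\<lbrakk>m \<in> carrier B; x \<in> carrier A\<rbrakk> \<Longrightarrow> P m (inv\<^bsub>A\<^esub> x) = inverse (P m x)"
  using P_mult_right[of m x "inv\<^bsub>A\<^esub> x"] P_nonzero[of m x] by (simp add: field_simps)

lemma P_inv_left: "\<lbrakk>m \<in> carrier B; x \<in> carrier A\<rbrakk> \<Longrightarrow> P (inv\<^bsub>B\<^esub> m) x = inverse (P m x)"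
  using P_mult_left[of m "inv\<^bsub>B\<^esub> m" x] P_nonzero[of m x] by (simp add: field_simps)

text \<open>The quotient of \<open>m\<close> and \<open>m'\<close> pairs trivially with all of
  \<open>A\<close>. This reduces identities in \<open>B\<close> to identities of pairing
  values.\<close>

lemma P_left_inject:
  assumes "m \<in> carrier B" "m' \<in> carrier B" "\<And>x. x \<in> carrier A \<Longrightarrow> P m x = P m' x"
  shows "m = m'"
proof -
  have "m \<otimes>\<^bsub>B\<^esub> inv\<^bsub>B\<^esub> m' = \<one>\<^bsub>B\<^esub>"
    using assms by (intro nondeg_left) (auto simp: P_mult_left P_inv_left P_nonzero)
  then show ?thesis
    using assms by (metis B.inv_equality B.inv_inv B.inv_closed)
qed

lemma sum_right:
  assumes "m \<in> carrier B"
  shows "(\<Sum>x\<in>carrier A. P m x) = (if m = \<one>\<^bsub>B\<^esub> then of_nat (card (carrier A)) else 0)"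
proof -
  have "(\<forall>x\<in>carrier A. P m x = 1) \<longleftrightarrow> m = \<one>\<^bsub>B\<^esub>"
    using nondeg_left[OF assms] by auto
  then show ?thesis
    using A.sum_character[of "P m"] assms by (simp add: P_mult_right)
qed

lemmas sum_left = dual_pair.sum_right[OF flip]

text \<open>Double counting: in the sum of \<open>P m x\<close> over all \<open>m\<close> and
  \<open>x\<close>, only the unit survives on the outside, whichever variable is summed
  first.\<close>

lemma card_eq: "card (carrier A) = card (carrier B)"
proof -
  have "(\<Sum>m\<in>carrier B. \<Sum>x\<in>carrier A. P m x) = of_nat (card (carrier A))"
    by (simp add: sum_right finite_B)
  moreover have "(\<Sum>x\<in>carrier A. \<Sum>m\<in>carrier B. P m x) = of_nat (card (carrier B))"
    by (simp add: sum_left finite_A)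
  ultimately show ?thesis
    by (metis of_nat_eq_iff sum.swap)
qed

text \<open>A character \<open>c\<close> different from all characters \<open>P m\<close> would be
  orthogonal to each of them. Summing these relations over \<open>m\<close> leaves only
  \<open>c\<close> at the unit times the order of \<open>B\<close>, which is nonzero.\<close>

lemma character_representable:
  assumes mult: "\<And>x y. x \<in> carrier A \<Longrightarrow> y \<in> carrier A \<Longrightarrow> c (x \<otimes>\<^bsub>A\<^esub> y) = c x * c y"
    and nz: "\<And>x. x \<in> carrier A \<Longrightarrow> c x \<noteq> (0::complex)"
  shows "\<exists>m\<in>carrier B. \<forall>x\<in>carrier A. P m x = c x"
proof (rule ccontr)
  assume neg: "\<not> ?thesis"
  have "(\<Sum>x\<in>carrier A. c x * P m x) = 0" if "m \<in> carrier B" for m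
  proof -
    \<comment> \<open>If this product were trivial, the inverse of \<open>m\<close> would represent
      \<open>c\<close>.\<close>
    have "\<not> (\<forall>x\<in>carrier A. c x * P m x = 1)"
    proof
      assume "\<forall>x\<in>carrier A. c x * P m x = 1"
      then have "\<forall>x\<in>carrier A. P (inv\<^bsub>B\<^esub> m) x = c x"
        using that by (auto simp: P_inv_left inverse_eq_divide divide_simps P_nonzero)
      with that neg show False by auto
    qed
    then show ?thesis
      using A.sum_character[of "\<lambda>x. c x * P m x"] that by (auto simp: P_mult_right mult)
  qed
  then have "0 = (\<Sum>m\<in>carrier B. \<Sum>x\<in>carrier A. c x * P m x)"
    by simp
  also have "\<dots> = (\<Sum>x\<in>carrier A. c x * (\<Sum>m\<in>carrier B. P m x))"
    by (subst sum.swap) (simp add: sum_distrib_left)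
  also have "\<dots> = c \<one>\<^bsub>A\<^esub> * of_nat (card (carrier B))"
    by (simp add: sum_left finite_A if_distrib cong: if_cong)
  finally show False
    using nz[of "\<one>\<^bsub>A\<^esub>"] finite_B by (auto simp: card_eq_0_iff)
qed

definition ann :: "'a set \<Rightarrow> 'b set" where
  "ann G = {m \<in> carrier B. \<forall>g\<in>G. P m g = 1}"

lemma subgroup_ann:
  assumes "G \<subseteq> carrier A"
  shows "subgroup (ann G) B"
  using assms by unfold_locales (auto simp: ann_def P_mult_left P_inv_left subset_iff)

text \<open>The sum of \<open>P m g\<close> over \<open>B\<close> and \<open>G\<close> is evaluated
  twice: for fixed \<open>m\<close> it detects membership in \<open>ann G\<close>, for fixed
  \<open>g\<close> only the unit contributes.\<close>

lemma card_ann: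
  assumes "subgroup G A"
  shows "card G * card (ann G) = card (carrier A)"
proof -
  have sub: "G \<subseteq> carrier A" using assms by (rule subgroup.subset)
  interpret G: group "A\<lparr>carrier := G\<rparr>" using assms by (rule A.subgroup_imp_group)
  have "(\<Sum>g\<in>G. P m g) = (if m \<in> ann G then of_nat (card G) else 0)" if "m \<in> carrier B" for m
    using G.sum_character[of "P m"] that sub by (auto simp: P_mult_right ann_def subset_iff)
  then have "(\<Sum>m\<in>carrier B. \<Sum>g\<in>G. P m g) = (\<Sum>m\<in>carrier B. if m \<in> ann G then of_nat (card G) else 0)"
    by simp
  also have "\<dots> = of_nat (card G * card (ann G))"
    by (simp add: sum.If_cases finite_B ann_def Int_def conj_commute)
  finally have 1: "(\<Sum>m\<in>carrier B. \<Sum>g\<in>G. P m g) = of_nat (card G * card (ann G))" .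
  have "(\<Sum>g\<in>G. \<Sum>m\<in>carrier B. P m g) = (\<Sum>g\<in>G. if g = \<one>\<^bsub>A\<^esub> then of_nat (card (carrier B)) else 0)"
    using sub by (intro sum.cong) (auto simp: sum_left)
  also have "\<dots> = of_nat (card (carrier B))"
    using assms sub finite_A by (simp add: finite_subset subgroup.one_closed)
  finally have "(\<Sum>g\<in>G. \<Sum>m\<in>carrier B. P m g) = of_nat (card (carrier B))" .
  with 1 show ?thesis
    by (metis card_eq of_nat_eq_iff sum.swap)
qed

text \<open>\<open>G\<close> lies in its double annihilator, and \<open>card_ann\<close>, applied
  once on each side of the pairing, shows that both have the same order.\<close>

lemma ann_ann:
  assumes "subgroup G A"
  shows "{x \<in> carrier A. \<forall>m\<in>ann G. P m x = 1} = G"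
proof -
  interpret op: dual_pair B A "\<lambda>x m. P m x" by (rule flip)
  have sub: "G \<subseteq> carrier A" using assms by (rule subgroup.subset)
  have opann: "op.ann (ann G) = {x \<in> carrier A. \<forall>m\<in>ann G. P m x = 1}"
    by (simp add: op.ann_def)
  have "card (ann G) * card (op.ann (ann G)) = card (carrier B)"
    using sub by (intro op.card_ann subgroup_ann)
  moreover have "card (ann G) > 0"
    using subgroup.one_closed[OF subgroup_ann[OF sub]] finite_B
    by (auto simp: card_gt_0_iff ann_def)
  ultimately have "card (op.ann (ann G)) = card G"
    using card_ann[OF assms] card_eq by (metis mult.commute mult_cancel1 not_gr_zero)
  moreover have "G \<subseteq> op.ann (ann G)"
    using sub by (auto simp: op.ann_def ann_def)
  ultimately show ?thesis
    using opann finite_A card_subset_eq[of "op.ann (ann G)" G] by simp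
qed

text \<open>By \<open>ann_ann\<close>, the elements of \<open>A\<close> that restrict to the trivial
  character of \<open>ann G\<close> are exactly those of \<open>G\<close>.\<close>

lemma sum_ann:
  assumes "subgroup G A" "x \<in> carrier A"
  shows "(\<Sum>m\<in>ann G. P m x) = (if x \<in> G then of_nat (card (ann G)) else 0)"
proof -
  have sub: "G \<subseteq> carrier A" using assms(1) by (rule subgroup.subset)
  interpret C: group "B\<lparr>carrier := ann G\<rparr>"
    using subgroup_ann[OF sub] by (rule B.subgroup_imp_group)
  have "(\<forall>m\<in>ann G. P m x = 1) \<longleftrightarrow> x \<in> G"
    using ann_ann[OF assms(1)] assms(2) by blast
  then show ?thesis
    using C.sum_character[of "\<lambda>m. P m x"] assms(2) by (simp add: ann_def P_mult_left)
qed

end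

section \<open>Dual actions and the comparison of the two counts\<close>

locale dual_actions = dual_pair A B P + A: aut_action A H \<phi>
  for A :: "('a, 'c) monoid_scheme" and B :: "('b, 'd) monoid_scheme" and P
    and H :: "('h, 'e) monoid_scheme" and \<phi> +
  fixes \<psi> :: "'h \<Rightarrow> 'b \<Rightarrow> 'b"
  assumes dual_closed: "\<lbrakk>h \<in> carrier H; m \<in> carrier B\<rbrakk> \<Longrightarrow> \<psi> h m \<in> carrier B"
    and dual_pairing: "\<lbrakk>h \<in> carrier H; m \<in> carrier B; x \<in> carrier A\<rbrakk> \<Longrightarrow>
      P (\<psi> h m) x = P m (\<phi> (inv\<^bsub>H\<^esub> h) x)"

text \<open>Adjointness to \<open>\<phi>\<close> and the separation of elements of \<open>B\<close>
  by the pairing force all action axioms. The inverse in \<open>dual_pairing\<close> is what makes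
  \<open>\<psi>\<close> a left action.\<close>

sublocale dual_actions \<subseteq> B: aut_action B H \<psi>
proof
  fix h assume h: "h \<in> carrier H"
  show "\<psi> h \<in> hom B B"
    unfolding hom_def
    using h by (auto intro!: P_left_inject simp: dual_closed dual_pairing P_mult_left)
  fix k m assume "k \<in> carrier H" "m \<in> carrier B"
  with h show "\<psi> (h \<otimes>\<^bsub>H\<^esub> k) m = \<psi> h (\<psi> k m)"
    by (intro P_left_inject)
      (auto simp: dual_closed dual_pairing A.H.inv_mult_group A.act_mult)
next
  fix m assume "m \<in> carrier B"
  then show "\<psi> \<one>\<^bsub>H\<^esub> m = m"
    by (intro P_left_inject) (auto simp: dual_closed dual_pairing A.act_one)
qed

context dual_actions
begin

lemma ann_invariant:
  assumes "G \<subseteq> carrier A" "\<And>h. h \<in> carrier H \<Longrightarrow> \<phi> h ` G \<subseteq> G" "h \<in> carrier H"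
  shows "\<psi> h ` ann G \<subseteq> ann G"
proof -
  have "\<phi> (inv\<^bsub>H\<^esub> h) ` G \<subseteq> G" using assms by simp
  with assms(1,3) show ?thesis
    by (auto simp: ann_def dual_pairing dual_closed subset_iff)
qed

text \<open>Orthogonality on \<open>A\<close> detects the equation in \<open>B\<close>, and orthogonality on \<open>ann G\<close> then detects
  membership in \<open>G\<close>.\<close>

lemma card_commuting_ann:
  assumes G: "subgroup G A" "\<And>h. h \<in> carrier H \<Longrightarrow> \<phi> h ` G \<subseteq> G"
    and h: "h \<in> carrier H" and k: "k \<in> carrier H"
  shows "card G * card {(\<alpha>, \<beta>) \<in> ann G \<times> ann G. \<alpha> \<otimes>\<^bsub>B\<^esub> \<psi> h \<beta> = \<beta> \<otimes>\<^bsub>B\<^esub> \<psi> k \<alpha>} =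
    card (ann G) * card {x \<in> carrier A. x \<otimes>\<^bsub>A\<^esub> inv\<^bsub>A\<^esub> (\<phi> h x) \<in> G \<and> x \<otimes>\<^bsub>A\<^esub> inv\<^bsub>A\<^esub> (\<phi> k x) \<in> G}"
    (is "_ * card ?N = _ * card ?M")
proof -
  interpret G: subgroup G A by (rule G)
  have ann_B: "m \<in> carrier B" if "m \<in> ann G" for m
    using that by (simp add: ann_def)
  have fin_ann: "finite (ann G)"
    using finite_B by (simp add: ann_def)
  have Ginv: "x \<in> G \<longleftrightarrow> inv\<^bsub>A\<^esub> x \<in> G" if "x \<in> carrier A" for x
    using that G.m_inv_closed by (metis A.inv_inv)
  have Gact: "x \<in> G \<longleftrightarrow> \<phi> l x \<in> G" if "x \<in> carrier A" "l \<in> carrier H" for x l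
    using that G(2)[of l] G(2)[of "inv\<^bsub>H\<^esub> l"] A.act_inv_act[of l x]
    by (metis A.H.inv_closed image_subset_iff)
  \<comment> \<open>The character sums yield conditions involving the inverse of \<open>h\<close>.
    Applying \<open>\<phi> h\<close>, which preserves \<open>G\<close>, brings them to the form in
    the claim.\<close>
  have condh: "\<phi> (inv\<^bsub>H\<^esub> h) x \<otimes>\<^bsub>A\<^esub> inv\<^bsub>A\<^esub> x \<in> G \<longleftrightarrow> x \<otimes>\<^bsub>A\<^esub> inv\<^bsub>A\<^esub> (\<phi> h x) \<in> G" if "x \<in> carrier A" for x
    using Gact[of "\<phi> (inv\<^bsub>H\<^esub> h) x \<otimes>\<^bsub>A\<^esub> inv\<^bsub>A\<^esub> x" h] that h by simp
  \<comment> \<open>Here \<open>\<phi> k\<close> yields the inverse of the wanted element, so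
    closure of \<open>G\<close> under inverses enters as well.\<close>
  have condk: "x \<otimes>\<^bsub>A\<^esub> inv\<^bsub>A\<^esub> (\<phi> (inv\<^bsub>H\<^esub> k) x) \<in> G \<longleftrightarrow> x \<otimes>\<^bsub>A\<^esub> inv\<^bsub>A\<^esub> (\<phi> k x) \<in> G" if "x \<in> carrier A" for x
    using Gact[of "x \<otimes>\<^bsub>A\<^esub> inv\<^bsub>A\<^esub> (\<phi> (inv\<^bsub>H\<^esub> k) x)" k] Ginv[of "x \<otimes>\<^bsub>A\<^esub> inv\<^bsub>A\<^esub> (\<phi> k x)"] that k
    by (simp add: A.inv_mult A.m_comm)
  have eq_iff: "\<alpha> \<otimes>\<^bsub>B\<^esub> \<psi> h \<beta> = \<beta> \<otimes>\<^bsub>B\<^esub> \<psi> k \<alpha> \<longleftrightarrow>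
      (\<alpha> \<otimes>\<^bsub>B\<^esub> \<psi> h \<beta>) \<otimes>\<^bsub>B\<^esub> inv\<^bsub>B\<^esub> (\<beta> \<otimes>\<^bsub>B\<^esub> \<psi> k \<alpha>) = \<one>\<^bsub>B\<^esub>" if "\<alpha> \<in> ann G" "\<beta> \<in> ann G" for \<alpha> \<beta>
    using that h k ann_B B.inv_solve_right' B.m_closed B.act_closed B.one_closed
    by (smt (verit) B.l_one B.inv_closed)
  \<comment> \<open>Moving \<open>\<psi>\<close> across the pairing separates the variables: one
    factor depends on \<open>\<alpha>\<close> alone, the other on \<open>\<beta>\<close>
    alone.\<close>
  have P_eq: "P ((\<alpha> \<otimes>\<^bsub>B\<^esub> \<psi> h \<beta>) \<otimes>\<^bsub>B\<^esub> inv\<^bsub>B\<^esub> (\<beta> \<otimes>\<^bsub>B\<^esub> \<psi> k \<alpha>)) x =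
      P \<alpha> (x \<otimes>\<^bsub>A\<^esub> inv\<^bsub>A\<^esub> (\<phi> (inv\<^bsub>H\<^esub> k) x)) * P \<beta> (\<phi> (inv\<^bsub>H\<^esub> h) x \<otimes>\<^bsub>A\<^esub> inv\<^bsub>A\<^esub> x)"
    if "\<alpha> \<in> ann G" "\<beta> \<in> ann G" "x \<in> carrier A" for \<alpha> \<beta> x
    using that h k ann_B by (simp add: P_mult_left P_mult_right P_inv_left P_inv_right dual_pairing)
  have "of_nat (card ?N * card (carrier A)) =
      (\<Sum>(\<alpha>, \<beta>)\<in>ann G \<times> ann G. if \<alpha> \<otimes>\<^bsub>B\<^esub> \<psi> h \<beta> = \<beta> \<otimes>\<^bsub>B\<^esub> \<psi> k \<alpha> then of_nat (card (carrier A)) else 0 :: complex)"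
    using fin_ann by (simp add: case_prod_unfold sum.If_cases Int_def mem_Times_iff conj_assoc)
  also have "\<dots> = (\<Sum>(\<alpha>, \<beta>)\<in>ann G \<times> ann G. \<Sum>x\<in>carrier A.
      P ((\<alpha> \<otimes>\<^bsub>B\<^esub> \<psi> h \<beta>) \<otimes>\<^bsub>B\<^esub> inv\<^bsub>B\<^esub> (\<beta> \<otimes>\<^bsub>B\<^esub> \<psi> k \<alpha>)) x)"
    using h k ann_B by (intro sum.cong) (auto simp: sum_right eq_iff)
  also have "\<dots> = (\<Sum>(\<alpha>, \<beta>)\<in>ann G \<times> ann G. \<Sum>x\<in>carrier A.
      P \<alpha> (x \<otimes>\<^bsub>A\<^esub> inv\<^bsub>A\<^esub> (\<phi> (inv\<^bsub>H\<^esub> k) x)) * P \<beta> (\<phi> (inv\<^bsub>H\<^esub> h) x \<otimes>\<^bsub>A\<^esub> inv\<^bsub>A\<^esub> x))"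
    by (intro sum.cong) (auto simp: P_eq)
  \<comment> \<open>With \<open>x\<close> outermost, the sum over pairs becomes a product of two
    sums to which \<open>sum_ann\<close> applies.\<close>
  also have "\<dots> = (\<Sum>x\<in>carrier A. (\<Sum>\<alpha>\<in>ann G. P \<alpha> (x \<otimes>\<^bsub>A\<^esub> inv\<^bsub>A\<^esub> (\<phi> (inv\<^bsub>H\<^esub> k) x))) *
      (\<Sum>\<beta>\<in>ann G. P \<beta> (\<phi> (inv\<^bsub>H\<^esub> h) x \<otimes>\<^bsub>A\<^esub> inv\<^bsub>A\<^esub> x)))"
    unfolding case_prod_unfold
    by (subst sum.swap) (simp add: sum_product sum.cartesian_product case_prod_unfold)
  also have "\<dots> = (\<Sum>x\<in>carrier A. if x \<otimes>\<^bsub>A\<^esub> inv\<^bsub>A\<^esub> (\<phi> h x) \<in> G \<and> x \<otimes>\<^bsub>A\<^esub> inv\<^bsub>A\<^esub> (\<phi> k x) \<in> G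
      then of_nat (card (ann G) * card (ann G)) else 0)"
    using h k by (intro sum.cong) (auto simp: sum_ann[OF G(1)] condh condk)
  also have "\<dots> = of_nat (card (ann G) * card (ann G) * card ?M)"
    using finite_A by (simp add: sum.If_cases Int_def)
  finally have "card ?N * card (carrier A) = card (ann G) * card (ann G) * card ?M"
    using of_nat_eq_iff by blast
  \<comment> \<open>\<open>card_ann\<close> factors the order of \<open>A\<close>; one factor
    \<open>card (ann G)\<close> then cancels.\<close>
  then have "card (ann G) * (card G * card ?N) = card (ann G) * (card (ann G) * card ?M)"
    by (simp flip: card_ann[OF G(1)] add: mult_ac)
  moreover have "card (ann G) \<noteq> 0"
    using subgroup.one_closed[OF subgroup_ann[OF G.subset]] fin_ann by auto
  ultimately show ?thesis by simp
qed

end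

section \<open>Orbifold Euler characteristics of semidirect products\<close>

text \<open>The elements fixing \<open>C\<close> are closed under products and inverses, so the
  fixed-point condition need only be checked on generators.\<close>

lemma (in group) fixed_by_generate_iff:
  assumes L: "subgroup L G" and gh: "g \<in> L" "h \<in> L" and C: "C \<subseteq> carrier G"
  shows "(\<forall>k\<in>generate (G\<lparr>carrier := L\<rparr>) {g, h}. k <# C = C) \<longleftrightarrow> g <# C = C \<and> h <# C = C"
proof
  assume fixp: "g <# C = C \<and> h <# C = C"
  have sub: "L \<subseteq> carrier G" using L by (rule subgroup.subset)
  \<comment> \<open>Membership in \<open>L\<close> is carried along because inverses are formed in
    the restricted group, where they agree with those of \<open>G\<close> for elements of
    \<open>L\<close>.\<close>
  have "k \<in> L \<and> k <# C = C" if "k \<in> generate (G\<lparr>carrier := L\<rparr>) {g, h}" for k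
    using that
  proof induction
    case one
    then show ?case using subgroup.one_closed[OF L] lcos_mult_one[OF C] by simp
  next
    case (incl k)
    then show ?case using fixp gh by auto
  next
    case (inv k)
    then have k: "k \<in> L" "k <# C = C" using fixp gh by auto
    then have "inv k <# C = inv k <# (k <# C)" by simp
    also have "\<dots> = C"
      using k sub by (subst lcos_m_assoc[OF C]) (auto simp: lcos_mult_one[OF C])
    finally show ?case
      using k by (simp add: m_inv_consistent[OF L] subgroup.m_inv_closed[OF L])
  next
    case (eng k l)
    then show ?case
      using sub lcos_m_assoc[OF C, of k l] by (auto simp: subgroup.m_closed[OF L])
  qed
  then show "\<forall>k\<in>generate (G\<lparr>carrier := L\<rparr>) {g, h}. k <# C = C" by blast
qed (auto intro: generate.incl)

context aut_action
begin

abbreviation (input) K where "K \<equiv> semidirect N H \<phi>"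

lemma mult_semidirect [simp]:
  "(x, h) \<otimes>\<^bsub>K\<^esub> (y, k) = (x \<otimes>\<^bsub>N\<^esub> \<phi> h y, h \<otimes>\<^bsub>H\<^esub> k)"
  by (simp add: semidirect_def)

lemma carrier_semidirect [simp]: "carrier K = carrier N \<times> carrier H"
  by (simp add: semidirect_def)

lemma invariant_image_eq:
  assumes Q: "subgroup Q N" "\<And>h. h \<in> carrier H \<Longrightarrow> \<phi> h ` Q \<subseteq> Q" and h: "h \<in> carrier H"
  shows "\<phi> h ` Q = Q"
proof
  show "Q \<subseteq> \<phi> h ` Q"
  proof
    fix q assume q: "q \<in> Q"
    then have "q = \<phi> h (\<phi> (inv\<^bsub>H\<^esub> h) q)"
      using h subgroup.mem_carrier[OF Q(1)] by simp
    then show "q \<in> \<phi> h ` Q"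
      using Q(2)[of "inv\<^bsub>H\<^esub> h"] q h by blast
  qed
qed (use Q h in simp)

lemma subgroup_semidirect:
  assumes L: "subgroup L N" "\<And>h. h \<in> carrier H \<Longrightarrow> \<phi> h ` L \<subseteq> L"
  shows "subgroup (L \<times> carrier H) K"
proof -
  interpret L: aut_action "N\<lparr>carrier := L\<rparr>" H \<phi>
    using L by (rule invariant_subgroup)
  have "semidirect (N\<lparr>carrier := L\<rparr>) H \<phi> = K\<lparr>carrier := L \<times> carrier H\<rparr>"
    by (simp add: semidirect_def)
  then have "group (K\<lparr>carrier := L \<times> carrier H\<rparr>)"
    using L.group_semidirect by simp
  moreover have "L \<times> carrier H \<subseteq> carrier K"
    using subgroup.subset[OF L(1)] by auto
  ultimately show ?thesis
    using group.group_incl_imp_subgroup[OF group_semidirect] by blast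
qed

text \<open>Left translation sends products of sets to products of sets, which allows the two
  components to be counted separately.\<close>

lemma l_coset_times:
  "(x, h) <#\<^bsub>K\<^esub> (Y \<times> D) = (x <#\<^bsub>N\<^esub> \<phi> h ` Y) \<times> (h <#\<^bsub>H\<^esub> D)"
  by (auto simp: l_coset_def)

text \<open>Since \<open>\<phi> h\<close> maps \<open>Q\<close> onto itself, the coset of
  \<open>(x, h)\<close> is the product of the coset of \<open>x\<close> and the coset of
  \<open>h\<close>.\<close>

lemma lcosets_semidirect:
  assumes Q: "subgroup Q N" "\<And>h. h \<in> carrier H \<Longrightarrow> \<phi> h ` Q \<subseteq> Q"
  shows "lcosets\<^bsub>K\<^esub> (Q \<times> T) = (\<lambda>(Y, D). Y \<times> D) ` ((lcosets\<^bsub>N\<^esub> Q) \<times> (lcosets\<^bsub>H\<^esub> T))"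
proof -
  have "lcosets\<^bsub>K\<^esub> (Q \<times> T) = (\<lambda>(x, h). (x <#\<^bsub>N\<^esub> Q) \<times> (h <#\<^bsub>H\<^esub> T)) ` (carrier N \<times> carrier H)"
    unfolding LCOSETS_def carrier_semidirect UNION_singleton_eq_range
    by (intro image_cong) (auto simp: l_coset_times invariant_image_eq[OF Q])
  also have "\<dots> = (\<lambda>(Y, D). Y \<times> D) ` map_prod (\<lambda>x. x <#\<^bsub>N\<^esub> Q) (\<lambda>h. h <#\<^bsub>H\<^esub> T) ` (carrier N \<times> carrier H)"
    by (simp add: image_image case_prod_unfold)
  finally show ?thesis
    by (simp add: LCOSETS_def UNION_singleton_eq_range map_prod_surj_on)
qed

text \<open>A product of nonempty sets determines its factors, so it is fixed exactly when each
  factor is.\<close>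

lemma card_fixed_cosets:
  assumes Q: "subgroup Q N" "\<And>h. h \<in> carrier H \<Longrightarrow> \<phi> h ` Q \<subseteq> Q" and T: "subgroup T H"
  shows "card {C \<in> lcosets\<^bsub>K\<^esub> (Q \<times> T). (g, h) <#\<^bsub>K\<^esub> C = C \<and> (g', k) <#\<^bsub>K\<^esub> C = C} =
    card {Y \<in> lcosets\<^bsub>N\<^esub> Q. g <#\<^bsub>N\<^esub> \<phi> h ` Y = Y \<and> g' <#\<^bsub>N\<^esub> \<phi> k ` Y = Y} *
    card {D \<in> lcosets\<^bsub>H\<^esub> T. h <#\<^bsub>H\<^esub> D = D \<and> k <#\<^bsub>H\<^esub> D = D}"
    (is "card ?F = card ?Y * card ?D")
proof -
  have neN: "Y \<noteq> {}" if "Y \<in> lcosets\<^bsub>N\<^esub> Q" for Y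
    using that subgroup.one_closed[OF Q(1)] by (auto simp: LCOSETS_def l_coset_def)
  have neH: "D \<noteq> {}" if "D \<in> lcosets\<^bsub>H\<^esub> T" for D
    using that subgroup.one_closed[OF T] by (auto simp: LCOSETS_def l_coset_def)
  have eq: "lcosets\<^bsub>K\<^esub> (Q \<times> T) = (\<lambda>(Y, D). Y \<times> D) ` ((lcosets\<^bsub>N\<^esub> Q) \<times> (lcosets\<^bsub>H\<^esub> T))"
    using Q by (rule lcosets_semidirect)
  have "?F = (\<lambda>(Y, D). Y \<times> D) ` (?Y \<times> ?D)"
    by (auto simp: eq l_coset_times times_eq_iff dest: neN neH)
  moreover have "inj_on (\<lambda>(Y, D). Y \<times> D) (?Y \<times> ?D)"
    by (auto simp: inj_on_def times_eq_iff dest: neN neH)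
  ultimately show ?thesis
    by (simp add: card_image card_cartesian_product)
qed

text \<open>Commuting pairs of the semidirect product are grouped by their components in
  \<open>H\<close>: \<open>(g, h)\<close> and \<open>(g', k)\<close> commute iff \<open>h\<close>
  and \<open>k\<close> do and the twisted equation for \<open>g\<close> and \<open>g'\<close> holds.
  The count of cosets of \<open>T\<close> depends only on \<open>h\<close> and \<open>k\<close> and
  factors out. General \<open>Q\<close> covers both sides of the duality.\<close>

lemma orbifold_euler_semidirect:
  assumes fin: "finite (carrier N)" "finite (carrier H)"
    and L: "subgroup L N" "\<And>h. h \<in> carrier H \<Longrightarrow> \<phi> h ` L \<subseteq> L"
    and Q: "subgroup Q N" "\<And>h. h \<in> carrier H \<Longrightarrow> \<phi> h ` Q \<subseteq> Q" and T: "subgroup T H"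
  shows "orbifold_euler (lcosets\<^bsub>K\<^esub> (Q \<times> T)) (K\<lparr>carrier := L \<times> carrier H\<rparr>) (\<lambda>g C. g <#\<^bsub>K\<^esub> C) =
    1 / real (card L * card (carrier H)) *
    (\<Sum>(h, k)\<in>{(h, k) \<in> carrier H \<times> carrier H. h \<otimes>\<^bsub>H\<^esub> k = k \<otimes>\<^bsub>H\<^esub> h}.
      real (card {D \<in> lcosets\<^bsub>H\<^esub> T. h <#\<^bsub>H\<^esub> D = D \<and> k <#\<^bsub>H\<^esub> D = D} *
        (\<Sum>(g, g')\<in>{(g, g') \<in> L \<times> L. g \<otimes>\<^bsub>N\<^esub> \<phi> h g' = g' \<otimes>\<^bsub>N\<^esub> \<phi> k g}.
          card {Y \<in> lcosets\<^bsub>N\<^esub> Q. g <#\<^bsub>N\<^esub> \<phi> h ` Y = Y \<and> g' <#\<^bsub>N\<^esub> \<phi> k ` Y = Y})))"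
    (is "_ = _ * (\<Sum>(h, k)\<in>?HH. real (?c h k * (\<Sum>(g, g')\<in>?LL h k. ?y g h g' k)))")
proof -
  interpret K: group K by (rule group_semidirect)
  have sub: "L \<subseteq> carrier N" using L(1) by (rule subgroup.subset)
  have finL: "finite L" using sub fin(1) by (rule finite_subset)
  have subC: "C \<subseteq> carrier K" if "C \<in> lcosets\<^bsub>K\<^esub> (Q \<times> T)" for C
  proof -
    have "Q \<times> T \<subseteq> carrier K" using subgroup.subset[OF Q(1)] subgroup.subset[OF T] by auto
    with that show ?thesis
      unfolding LCOSETS_def using K.l_coset_subset_G by blast
  qed
  let ?P = "{(x, y). x \<in> L \<times> carrier H \<and> y \<in> L \<times> carrier H \<and> x \<otimes>\<^bsub>K\<^esub> y = y \<otimes>\<^bsub>K\<^esub> x}"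
  have fixed: "{C \<in> lcosets\<^bsub>K\<^esub> (Q \<times> T).
        \<forall>k\<in>generate (K\<lparr>carrier := L \<times> carrier H\<rparr>) {x, y}. k <#\<^bsub>K\<^esub> C = C} =
      {C \<in> lcosets\<^bsub>K\<^esub> (Q \<times> T). x <#\<^bsub>K\<^esub> C = C \<and> y <#\<^bsub>K\<^esub> C = C}" if "(x, y) \<in> ?P" for x y
    using that by (intro Collect_cong conj_cong refl K.fixed_by_generate_iff subgroup_semidirect[OF L] subC) auto
  have "(\<Sum>(x, y)\<in>?P. real (card {C \<in> lcosets\<^bsub>K\<^esub> (Q \<times> T).
        \<forall>k\<in>generate (K\<lparr>carrier := L \<times> carrier H\<rparr>) {x, y}. k <#\<^bsub>K\<^esub> C = C})) =
      (\<Sum>((g, h), (g', k))\<in>?P. real (?c h k * ?y g h g' k))"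
    using fixed by (intro sum.cong) (auto simp: card_fixed_cosets[OF Q T])
  also have "\<dots> = (\<Sum>((h, k), (g, g'))\<in>(SIGMA (h, k):?HH. ?LL h k). real (?c h k * ?y g h g' k))"
    by (rule sum.reindex_bij_witness[of _ "\<lambda>((h, k), (g, g')). ((g, h), (g', k))"
          "\<lambda>((g, h), (g', k)). ((h, k), (g, g'))"]) auto
  also have "\<dots> = (\<Sum>(h, k)\<in>?HH. \<Sum>(g, g')\<in>?LL h k. real (?c h k * ?y g h g' k))"
    using fin(2) finL by (subst sum.Sigma[symmetric])
      (auto simp: case_prod_unfold intro: finite_subset[of _ "L \<times> L"] finite_subset[of _ "carrier H \<times> carrier H"])
  also have "\<dots> = (\<Sum>(h, k)\<in>?HH. real (?c h k * (\<Sum>(g, g')\<in>?LL h k. ?y g h g' k)))"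
    by (simp add: case_prod_unfold sum_distrib_left)
  finally show ?thesis
    by (simp add: orbifold_euler_def card_cartesian_product)
qed

text \<open>The cosets of the trivial subgroup are points \<open>x\<close>, and the fixed-point
  equations determine \<open>g\<close> and \<open>g'\<close> from \<open>x\<close>. Hence counting
  triples \<open>((g, g'), x)\<close> amounts to counting the admissible \<open>x\<close>.\<close>

lemma sum_fixed_points:
  assumes fin: "finite (carrier N)"
    and L: "subgroup L N"
    and h: "h \<in> carrier H" and k: "k \<in> carrier H" and comm: "h \<otimes>\<^bsub>H\<^esub> k = k \<otimes>\<^bsub>H\<^esub> h"
  shows "(\<Sum>(g, g')\<in>{(g, g') \<in> L \<times> L. g \<otimes>\<^bsub>N\<^esub> \<phi> h g' = g' \<otimes>\<^bsub>N\<^esub> \<phi> k g}.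
      card {Y \<in> lcosets\<^bsub>N\<^esub> {\<one>\<^bsub>N\<^esub>}. g <#\<^bsub>N\<^esub> \<phi> h ` Y = Y \<and> g' <#\<^bsub>N\<^esub> \<phi> k ` Y = Y}) =
    card {x \<in> carrier N. x \<otimes>\<^bsub>N\<^esub> inv\<^bsub>N\<^esub> (\<phi> h x) \<in> L \<and> x \<otimes>\<^bsub>N\<^esub> inv\<^bsub>N\<^esub> (\<phi> k x) \<in> L}"
    (is "(\<Sum>(g, g')\<in>?P. _) = card ?M")
proof -
  have sub: "L \<subseteq> carrier N" using L by (rule subgroup.subset)
  have finP: "finite ?P"
    using finite_subset[OF sub fin] by (auto intro: finite_subset[of _ "L \<times> L"])
  have "card {Y \<in> lcosets\<^bsub>N\<^esub> {\<one>\<^bsub>N\<^esub>}. g <#\<^bsub>N\<^esub> \<phi> h ` Y = Y \<and> g' <#\<^bsub>N\<^esub> \<phi> k ` Y = Y} =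
      card {x \<in> carrier N. g \<otimes>\<^bsub>N\<^esub> \<phi> h x = x \<and> g' \<otimes>\<^bsub>N\<^esub> \<phi> k x = x}" for g g'
  proof -
    have "{Y \<in> lcosets\<^bsub>N\<^esub> {\<one>\<^bsub>N\<^esub>}. g <#\<^bsub>N\<^esub> \<phi> h ` Y = Y \<and> g' <#\<^bsub>N\<^esub> \<phi> k ` Y = Y} =
        (\<lambda>x. {x}) ` {x \<in> carrier N. g \<otimes>\<^bsub>N\<^esub> \<phi> h x = x \<and> g' \<otimes>\<^bsub>N\<^esub> \<phi> k x = x}"
      by (auto simp: LCOSETS_def l_coset_def)
    then show ?thesis by (simp add: card_image)
  qed
  then have "(\<Sum>(g, g')\<in>?P. card {Y \<in> lcosets\<^bsub>N\<^esub> {\<one>\<^bsub>N\<^esub>}. g <#\<^bsub>N\<^esub> \<phi> h ` Y = Y \<and> g' <#\<^bsub>N\<^esub> \<phi> k ` Y = Y}) =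
      card (SIGMA (g, g'):?P. {x \<in> carrier N. g \<otimes>\<^bsub>N\<^esub> \<phi> h x = x \<and> g' \<otimes>\<^bsub>N\<^esub> \<phi> k x = x})"
    using fin finP by (subst card_SigmaI) (auto simp: case_prod_unfold)
  also have "\<dots> = card ?M"
  proof (rule bij_betw_same_card)
    have solve: "g = x \<otimes>\<^bsub>N\<^esub> inv\<^bsub>N\<^esub> (\<phi> l x)" if "g \<in> L" "x \<in> carrier N" "l \<in> carrier H" "g \<otimes>\<^bsub>N\<^esub> \<phi> l x = x" for g x l
      using that sub by (metis N.inv_solve_right' act_closed subsetD)
    have comm': "\<phi> h (\<phi> k x) = \<phi> k (\<phi> h x)" if "x \<in> carrier N" for x
      using h k that comm by (metis act_mult)
    have cancel: "inv\<^bsub>N\<^esub> x \<otimes>\<^bsub>N\<^esub> (x \<otimes>\<^bsub>N\<^esub> y) = y" if "x \<in> carrier N" "y \<in> carrier N" for x y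
      using that by (simp flip: N.m_assoc)
    \<comment> \<open>For the recovered \<open>g\<close> and \<open>g'\<close>, both sides of the
      twisted equation collapse to \<open>x\<close> divided by \<open>\<phi> h (\<phi> k x)\<close>;
      this uses that \<open>h\<close> and \<open>k\<close> commute.\<close>
    show "bij_betw snd (SIGMA (g, g'):?P. {x \<in> carrier N. g \<otimes>\<^bsub>N\<^esub> \<phi> h x = x \<and> g' \<otimes>\<^bsub>N\<^esub> \<phi> k x = x}) ?M"
      by (rule bij_betw_byWitness[where f' = "\<lambda>x. ((x \<otimes>\<^bsub>N\<^esub> inv\<^bsub>N\<^esub> (\<phi> h x), x \<otimes>\<^bsub>N\<^esub> inv\<^bsub>N\<^esub> (\<phi> k x)), x)"])
        ((use h k in \<open>auto simp: N.m_assoc comm' cancel\<close>), (metis solve h k)+)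
  qed
  finally show ?thesis .
qed

lemma lcosets_carrier: "lcosets\<^bsub>N\<^esub> (carrier N) = {carrier N}"
proof -
  have "x <#\<^bsub>N\<^esub> carrier N = carrier N" if "x \<in> carrier N" for x
    using that by (simp add: N.coset_join3 N.subgroup_self)
  then show ?thesis by (auto simp: LCOSETS_def)
qed

lemma card_fixed_carrier:
  assumes "g \<in> carrier N" "g' \<in> carrier N" "h \<in> carrier H" "k \<in> carrier H"
  shows "card {Y \<in> lcosets\<^bsub>N\<^esub> (carrier N). g <#\<^bsub>N\<^esub> \<phi> h ` Y = Y \<and> g' <#\<^bsub>N\<^esub> \<phi> k ` Y = Y} = 1"
proof -
  have "\<phi> l ` carrier N = carrier N" if "l \<in> carrier H" for l
    using that by (intro invariant_image_eq N.subgroup_self) auto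
  then have "{Y \<in> lcosets\<^bsub>N\<^esub> (carrier N). g <#\<^bsub>N\<^esub> \<phi> h ` Y = Y \<and> g' <#\<^bsub>N\<^esub> \<phi> k ` Y = Y} = {carrier N}"
    using assms by (auto simp: lcosets_carrier N.coset_join3 N.subgroup_self)
  then show ?thesis by simp
qed

end

text \<open>The same expansion is used on both sides, with \<open>Q\<close> trivial for
  \<open>A\<close> and \<open>Q\<close> the whole group for \<open>B\<close>;
  \<open>card_commuting_ann\<close> then matches the summands for each pair
  \<open>(h, k)\<close>.\<close>

theorem (in dual_actions) orbifold_euler_dual:
  assumes fin: "finite (carrier H)" and T: "subgroup T H"
    and G: "subgroup G A" "\<And>h. h \<in> carrier H \<Longrightarrow> \<phi> h ` G \<subseteq> G"
  shows "orbifold_euler (lcosets\<^bsub>semidirect A H \<phi>\<^esub> ({\<one>\<^bsub>A\<^esub>} \<times> T))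
      ((semidirect A H \<phi>)\<lparr>carrier := G \<times> carrier H\<rparr>) (\<lambda>g C. g <#\<^bsub>semidirect A H \<phi>\<^esub> C) =
    orbifold_euler (lcosets\<^bsub>semidirect B H \<psi>\<^esub> (carrier B \<times> T))
      ((semidirect B H \<psi>)\<lparr>carrier := ann G \<times> carrier H\<rparr>) (\<lambda>g C. g <#\<^bsub>semidirect B H \<psi>\<^esub> C)"
proof -
  let ?HH = "{(h, k) \<in> carrier H \<times> carrier H. h \<otimes>\<^bsub>H\<^esub> k = k \<otimes>\<^bsub>H\<^esub> h}"
  let ?c = "\<lambda>h k. card {D \<in> lcosets\<^bsub>H\<^esub> T. h <#\<^bsub>H\<^esub> D = D \<and> k <#\<^bsub>H\<^esub> D = D}"
  let ?M = "\<lambda>h k. card {x \<in> carrier A. x \<otimes>\<^bsub>A\<^esub> inv\<^bsub>A\<^esub> (\<phi> h x) \<in> G \<and> x \<otimes>\<^bsub>A\<^esub> inv\<^bsub>A\<^esub> (\<phi> k x) \<in> G}"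
  let ?N = "\<lambda>h k. card {(\<alpha>, \<beta>) \<in> ann G \<times> ann G. \<alpha> \<otimes>\<^bsub>B\<^esub> \<psi> h \<beta> = \<beta> \<otimes>\<^bsub>B\<^esub> \<psi> k \<alpha>}"
  have sub: "G \<subseteq> carrier A" using G(1) by (rule subgroup.subset)
  have ann: "subgroup (ann G) B" using sub by (rule subgroup_ann)
  have triv: "\<phi> h ` {\<one>\<^bsub>A\<^esub>} \<subseteq> {\<one>\<^bsub>A\<^esub>}" if "h \<in> carrier H" for h
    using that by simp
  have pos: "card G > 0" "card (ann G) > 0"
    using subgroup.one_closed[OF G(1)] subgroup.one_closed[OF ann]
      finite_subset[OF sub finite_A] finite_subset[OF subgroup.subset[OF ann] finite_B]
    by (auto simp: card_gt_0_iff)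
  have "orbifold_euler (lcosets\<^bsub>semidirect A H \<phi>\<^esub> ({\<one>\<^bsub>A\<^esub>} \<times> T))
      ((semidirect A H \<phi>)\<lparr>carrier := G \<times> carrier H\<rparr>) (\<lambda>g C. g <#\<^bsub>semidirect A H \<phi>\<^esub> C) =
    1 / real (card G * card (carrier H)) * (\<Sum>(h, k)\<in>?HH. real (?c h k * ?M h k))"
    by (subst A.orbifold_euler_semidirect[OF finite_A fin G A.triv_subgroup triv T], simp)
      (rule arg_cong2[of _ _ _ _ "(*)"], rule refl, rule sum.cong, rule refl, clarify,
        simp only: A.sum_fixed_points[OF finite_A G(1)])
  also have "\<dots> = 1 / real (card (ann G) * card (carrier H)) * (\<Sum>(h, k)\<in>?HH. real (?c h k * ?N h k))"
  proof -
    have "real (?c h k * ?M h k) / real (card G) = real (?c h k * ?N h k) / real (card (ann G))"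
      if "(h, k) \<in> ?HH" for h k
    proof -
      have "real (card G) * real (?N h k) = real (card (ann G)) * real (?M h k)"
        using card_commuting_ann[OF G, of h k] that by (simp flip: of_nat_mult)
      then show ?thesis using pos by (simp add: field_simps)
    qed
    then have "(\<Sum>(h, k)\<in>?HH. real (?c h k * ?M h k) / real (card G)) =
        (\<Sum>(h, k)\<in>?HH. real (?c h k * ?N h k) / real (card (ann G)))"
      by (intro sum.cong) auto
    then have "(\<Sum>(h, k)\<in>?HH. real (?c h k * ?M h k)) / real (card G) =
        (\<Sum>(h, k)\<in>?HH. real (?c h k * ?N h k)) / real (card (ann G))"
      by (simp only: case_prod_unfold sum_divide_distrib)
    then show ?thesis
      by (metis (no_types, lifting) divide_divide_eq_left mult.left_neutral of_nat_mult times_divide_eq_left)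
  qed
  also have "\<dots> = orbifold_euler (lcosets\<^bsub>semidirect B H \<psi>\<^esub> (carrier B \<times> T))
      ((semidirect B H \<psi>)\<lparr>carrier := ann G \<times> carrier H\<rparr>) (\<lambda>g C. g <#\<^bsub>semidirect B H \<psi>\<^esub> C)"
  proof -
    \<comment> \<open>The single coset of the whole group is always fixed, so each pair contributes
      1 and the sum is a plain count.\<close>
    have sum_card: "(\<Sum>(g, g')\<in>{(\<alpha>, \<beta>) \<in> ann G \<times> ann G. \<alpha> \<otimes>\<^bsub>B\<^esub> \<psi> h \<beta> = \<beta> \<otimes>\<^bsub>B\<^esub> \<psi> k \<alpha>}.
        card {Y \<in> lcosets\<^bsub>B\<^esub> (carrier B). g <#\<^bsub>B\<^esub> \<psi> h ` Y = Y \<and> g' <#\<^bsub>B\<^esub> \<psi> k ` Y = Y}) = ?N h k"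
      if "h \<in> carrier H" "k \<in> carrier H" for h k
    proof -
      have "(\<Sum>(g, g')\<in>{(\<alpha>, \<beta>) \<in> ann G \<times> ann G. \<alpha> \<otimes>\<^bsub>B\<^esub> \<psi> h \<beta> = \<beta> \<otimes>\<^bsub>B\<^esub> \<psi> k \<alpha>}.
          card {Y \<in> lcosets\<^bsub>B\<^esub> (carrier B). g <#\<^bsub>B\<^esub> \<psi> h ` Y = Y \<and> g' <#\<^bsub>B\<^esub> \<psi> k ` Y = Y}) =
        (\<Sum>p\<in>{(\<alpha>, \<beta>) \<in> ann G \<times> ann G. \<alpha> \<otimes>\<^bsub>B\<^esub> \<psi> h \<beta> = \<beta> \<otimes>\<^bsub>B\<^esub> \<psi> k \<alpha>}. 1)"
        using that subgroup.mem_carrier[OF ann] by (intro sum.cong) (auto simp: B.card_fixed_carrier)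
      then show ?thesis by simp
    qed
    have invariant: "\<psi> h ` carrier B \<subseteq> carrier B" if "h \<in> carrier H" for h
      using that by auto
    show ?thesis
      by (subst B.orbifold_euler_semidirect[OF finite_B fin ann ann_invariant[OF sub G(2)]
            B.subgroup_self invariant T], simp, simp)
        (rule arg_cong2[of _ _ _ _ "(*)"], rule refl, rule sum.cong, rule refl, clarify,
          simp only: sum_card)
  qed
  finally show ?thesis .
qed

section \<open>Diagonal symmetries\<close>

definition real_mat :: "nat^'n^'n \<Rightarrow> real^'n^'n" where
  "real_mat E = (\<chi> i j. real (E $ i $ j))"

definition e2pi :: "real \<Rightarrow> complex" where
  "e2pi r = cis (2 * pi * r)"

definition e2pi_vec :: "real^'n \<Rightarrow> complex^'n" where
  "e2pi_vec v = (\<chi> j. e2pi (v $ j))"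

text \<open>The kernel of the endomorphism of the complex torus given by the monomials;
  \<open>carrier_diag_sym\<close> identifies it with the symmetry group.\<close>

definition torus_kernel :: "nat^'n^'n \<Rightarrow> (complex^'n) set" where
  "torus_kernel E = {l. (\<forall>j. l $ j \<noteq> 0) \<and> (\<forall>i. (\<Prod>j\<in>UNIV. l $ j ^ (E $ i $ j)) = 1)}"

lemma real_mat_transpose: "real_mat (transpose E) = transpose (real_mat E)"
  by (simp add: real_mat_def transpose_def)

lemma invertible_real_mat:
  assumes "det (\<chi> i j. int (E $ i $ j)) \<noteq> 0"
  shows "invertible (real_mat E)"
proof -
  have "det (real_mat E) = of_int (det (\<chi> i j. int (E $ i $ j)))"
    by (simp add: det_def real_mat_def)
  then show ?thesis using assms by (simp add: invertible_det_nz)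
qed

lemma invertible_real_mat_transpose:
  "invertible (real_mat E) \<Longrightarrow> invertible (real_mat (transpose E))"
  by (simp add: real_mat_transpose invertible_det_nz)

lemma real_mat_inverse:
  assumes "invertible (real_mat E)"
  shows "\<exists>W. (\<forall>y. real_mat E *v (W *v y) = y) \<and> (\<forall>x. W *v (real_mat E *v x) = x)"
proof -
  obtain W where "real_mat E ** W = mat 1" "W ** real_mat E = mat 1"
    using assms unfolding invertible_def by blast
  then have "(\<forall>y. real_mat E *v (W *v y) = y) \<and> (\<forall>x. W *v (real_mat E *v x) = x)"
    by (simp add: matrix_vector_mul_assoc)
  then show ?thesis ..
qed

lemma e2pi_add: "e2pi (r + s) = e2pi r * e2pi s"
  by (simp add: e2pi_def cis_mult distrib_left)

lemma e2pi_power: "e2pi r ^ n = e2pi (real n * r)"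
  unfolding e2pi_def Complex.DeMoivre by (simp add: mult_ac)

lemma e2pi_sum: "e2pi (\<Sum>j\<in>J. r j) = (\<Prod>j\<in>J. e2pi (r j))"
  by (induction J rule: infinite_finite_induct) (auto simp: e2pi_add, auto simp: e2pi_def)

lemma e2pi_nonzero [simp]: "e2pi r \<noteq> 0"
  by (simp add: e2pi_def)

lemma e2pi_eq_1_iff: "e2pi r = 1 \<longleftrightarrow> r \<in> \<int>"
proof
  assume "e2pi r = 1"
  then have "cos (2 * pi * r) = 1" by (simp add: e2pi_def complex_eq_iff)
  then obtain n :: int where "2 * pi * r = n * 2 * pi" by (auto simp: cos_one_2pi_int)
  then have "r = of_int n" by simp
  then show "r \<in> \<int>" by simp
qed (simp add: e2pi_def)

lemma e2pi_eq_iff: "e2pi r = e2pi s \<longleftrightarrow> r - s \<in> \<int>"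
proof -
  have "e2pi r = e2pi (r - s) * e2pi s" by (simp flip: e2pi_add)
  then show ?thesis by (simp flip: e2pi_eq_1_iff)
qed

lemma e2pi_vec_nth [simp]: "e2pi_vec v $ j = e2pi (v $ j)"
  by (simp add: e2pi_vec_def)

lemma e2pi_vec_add: "e2pi_vec (u + v) = e2pi_vec u * e2pi_vec v"
  by (simp add: vec_eq_iff e2pi_add)

lemma e2pi_vec_log_vec:
  assumes "\<And>j. cmod (l $ j) = 1"
  shows "e2pi_vec (log_vec l) = l"
proof -
  have "cis (Arg (l $ j)) = l $ j" for j
    using rcis_cmod_Arg[of "l $ j"] assms[of j] by (simp add: cis_rcis_eq)
  then show ?thesis
    by (simp add: vec_eq_iff log_vec_def e2pi_def)
qed

text \<open>In exponential coordinates monomials become linear: the \<open>i\<close>-th one takes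
  the value \<open>e2pi ((real_mat E *v v) $ i)\<close>.\<close>

lemma e2pi_vec_in_torus_kernel:
  "e2pi_vec v \<in> torus_kernel E \<longleftrightarrow> (\<forall>i. (real_mat E *v v) $ i \<in> \<int>)"
  by (simp add: torus_kernel_def e2pi_power matrix_vector_mult_def real_mat_def
      flip: e2pi_sum e2pi_eq_1_iff)

text \<open>The logarithms of the absolute values of the entries form a vector annihilated by the
  invertible matrix \<open>real_mat E\<close>.\<close>

lemma norm_torus_kernel:
  assumes inv: "invertible (real_mat E)" and l: "l \<in> torus_kernel E"
  shows "cmod (l $ j) = 1"
proof -
  obtain W where W: "\<And>y. real_mat E *v (W *v y) = y" "\<And>x. W *v (real_mat E *v x) = x"
    using real_mat_inverse[OF inv] by (elim exE conjE) auto
  let ?v = "(\<chi> j. ln (cmod (l $ j))) :: real^'a"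
  have "(real_mat E *v ?v) $ i = 0" for i
  proof -
    have "(real_mat E *v ?v) $ i = ln (\<Prod>j\<in>UNIV. cmod (l $ j) ^ (E $ i $ j))"
      using l by (subst ln_prod) (auto simp: torus_kernel_def real_mat_def matrix_vector_mult_def ln_realpow)
    also have "(\<Prod>j\<in>UNIV. cmod (l $ j) ^ (E $ i $ j)) = cmod (\<Prod>j\<in>UNIV. l $ j ^ (E $ i $ j))"
      by (simp add: norm_power flip: prod_norm)
    finally show ?thesis using l by (simp add: torus_kernel_def)
  qed
  then have "real_mat E *v ?v = 0" by (simp add: vec_eq_iff)
  then have "?v = 0" using W(2)[of ?v] by simp
  then have "ln (cmod (l $ j)) = 0" by (simp add: vec_eq_iff)
  then show ?thesis using l by (simp add: torus_kernel_def)
qed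

lemma e2pi_vec_log_vec_kernel:
  "\<lbrakk>invertible (real_mat E); l \<in> torus_kernel E\<rbrakk> \<Longrightarrow> e2pi_vec (log_vec l) = l"
  by (simp add: e2pi_vec_log_vec norm_torus_kernel)

lemma torus_kernel_cases:
  assumes "invertible (real_mat E)" "l \<in> torus_kernel E"
  obtains v where "l = e2pi_vec v" "\<And>i. (real_mat E *v v) $ i \<in> \<int>"
  using e2pi_vec_log_vec_kernel[OF assms] assms(2) e2pi_vec_in_torus_kernel by metis

text \<open>\<open>real_mat E\<close> sends \<open>log_vec l\<close> to an integer vector whose
  entries are bounded by the largest row sum \<open>b\<close>. There are finitely many such vectors,
  and each determines \<open>l\<close> through the inverse matrix.\<close>

lemma finite_torus_kernel:
  assumes inv: "invertible (real_mat E)"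
  shows "finite (torus_kernel E)"
proof -
  obtain W where W: "\<And>y. real_mat E *v (W *v y) = y" "\<And>x. W *v (real_mat E *v x) = x"
    using real_mat_inverse[OF inv] by (elim exE conjE) auto
  define b where "b = Max (range (\<lambda>i. \<Sum>j\<in>UNIV. real (E $ i $ j)))"
  define Z where "Z = {r::real. r \<in> \<int> \<and> \<bar>r\<bar> \<le> b}"
  have "finite {k::real^'a. \<forall>i. k $ i \<in> Z}"
  proof -
    have sub: "{k::real^'a. \<forall>i. k $ i \<in> Z} \<subseteq> vec_lambda ` (UNIV \<rightarrow>\<^sub>E Z)"
      by (auto simp: image_iff intro!: bexI[of _ "\<lambda>i. _ $ i"])
    have "finite Z"
      unfolding Z_def by (rule finite_abs_int_segment)
    then show ?thesis
      by (intro finite_subset[OF sub] finite_imageI finite_PiE) auto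
  qed
  moreover have "torus_kernel E \<subseteq> (\<lambda>k. e2pi_vec (W *v k)) ` {k. \<forall>i. k $ i \<in> Z}"
  proof
    fix l assume l: "l \<in> torus_kernel E"
    let ?v = "log_vec l"
    have small: "\<bar>?v $ j\<bar> \<le> 1" for j
      using Arg_bounded[of "l $ j"] by (auto simp: log_vec_def abs_le_iff field_simps)
    have "\<bar>(real_mat E *v ?v) $ i\<bar> \<le> b" for i
    proof -
      have "\<bar>(real_mat E *v ?v) $ i\<bar> \<le> (\<Sum>j\<in>UNIV. \<bar>real (E $ i $ j) * ?v $ j\<bar>)"
        unfolding matrix_vector_mult_def real_mat_def by (simp add: sum_abs)
      also have "\<dots> \<le> (\<Sum>j\<in>UNIV. real (E $ i $ j))"
        using small by (intro sum_mono) (simp add: abs_mult mult_left_le)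
      also have "\<dots> \<le> b"
        by (simp add: b_def)
      finally show ?thesis .
    qed
    moreover have "(real_mat E *v ?v) $ i \<in> \<int>" for i
      using l e2pi_vec_log_vec_kernel[OF inv l] e2pi_vec_in_torus_kernel[of ?v E] by simp
    moreover have "l = e2pi_vec (W *v (real_mat E *v ?v))"
      by (simp add: W e2pi_vec_log_vec_kernel[OF inv l])
    ultimately show "l \<in> (\<lambda>k. e2pi_vec (W *v k)) ` {k. \<forall>i. k $ i \<in> Z}"
      unfolding Z_def by blast
  qed
  ultimately show ?thesis by (meson finite_imageI finite_subset)
qed

text \<open>Taking logarithms turns the system into a linear one with matrix
  \<open>real_mat E\<close>; exponentiating its solution gives a positive real
  \<open>x\<close>.\<close>

lemma monomials_surj:
  fixes E :: "nat^'n^'n"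
  assumes inv: "invertible (real_mat E)" and y: "\<And>i. y $ i > 0"
  obtains x :: "complex^'n" where "\<And>i. (\<Prod>j\<in>UNIV. x $ j ^ (E $ i $ j)) = of_real (y $ i)"
proof -
  obtain W where W: "\<And>y. real_mat E *v (W *v y) = y" "\<And>x. W *v (real_mat E *v x) = x"
    using real_mat_inverse[OF inv] by (elim exE conjE) auto
  define v where "v = W *v (\<chi> i. ln (y $ i))"
  have "(\<Prod>j\<in>UNIV. exp (v $ j) ^ (E $ i $ j)) = y $ i" for i
  proof -
    have "(\<Prod>j\<in>UNIV. exp (v $ j) ^ (E $ i $ j)) = exp ((real_mat E *v v) $ i)"
      by (simp add: matrix_vector_mult_def real_mat_def exp_sum exp_of_nat_mult)
    also have "\<dots> = y $ i" using y[of i] by (simp add: v_def W)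
    finally show ?thesis .
  qed
  then have "(\<Prod>j\<in>UNIV. (\<chi> j. of_real (exp (v $ j))) $ j ^ (E $ i $ j)) = complex_of_real (y $ i)" for i
    by (simp flip: of_real_power of_real_prod)
  then show thesis by (rule that)
qed

text \<open>Positive values can be prescribed to the monomials independently of each other, so an
  invariant \<open>f\<close> forces every single monomial to be invariant.\<close>

lemma carrier_diag_sym:
  fixes E :: "nat^'n^'n"
  assumes inv: "invertible (real_mat E)" and a: "\<And>i. a $ i \<noteq> 0"
  shows "carrier (diag_sym (monomial_sum a E)) = torus_kernel E"
proof -
  have "(\<forall>x. monomial_sum a E (l * x) = monomial_sum a E x) \<longleftrightarrow>
      (\<forall>i. (\<Prod>j\<in>UNIV. l $ j ^ (E $ i $ j)) = 1)" for l
  proof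
    assume inva: "\<forall>x. monomial_sum a E (l * x) = monomial_sum a E x"
    \<comment> \<open>The coefficients of \<open>f (l * x) - f x\<close> as a linear form in the
      values of the monomials at \<open>x\<close>.\<close>
    define c where "c i = a $ i * ((\<Prod>j\<in>UNIV. l $ j ^ (E $ i $ j)) - 1)" for i
    have zero: "(\<Sum>i\<in>UNIV. c i * of_real (y $ i)) = 0" if y: "\<And>i. y $ i > 0" for y
    proof -
      obtain x :: "complex^'n" where x: "\<And>i. (\<Prod>j\<in>UNIV. x $ j ^ (E $ i $ j)) = of_real (y $ i)"
        using monomials_surj[OF inv y] by blast
      have "(\<Sum>i\<in>UNIV. c i * of_real (y $ i)) = monomial_sum a E (l * x) - monomial_sum a E x"
        by (simp add: monomial_sum_def c_def power_mult_distrib prod.distrib x algebra_simps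
            flip: sum_subtractf)
      then show ?thesis using inva by simp
    qed
    have "c k = 0" for k
    proof -
      \<comment> \<open>Both the all-ones vector and its sum with a unit vector are positive, hence
        allowed in \<open>zero\<close>; their difference isolates \<open>c k\<close>.\<close>
      have "(\<Sum>i\<in>UNIV. c i * of_real ((1 + axis k 1 :: real^'n) $ i)) =
          (\<Sum>i\<in>UNIV. c i * of_real ((1 :: real^'n) $ i)) + (\<Sum>i\<in>UNIV. if i = k then c i else 0)"
        unfolding sum.distrib[symmetric] by (intro sum.cong) (auto simp: axis_def algebra_simps)
      moreover have "(\<Sum>i\<in>UNIV. c i * of_real ((1 + axis k 1 :: real^'n) $ i)) = 0"
        by (rule zero) (simp add: axis_def)
      moreover have "(\<Sum>i\<in>UNIV. c i * of_real ((1 :: real^'n) $ i)) = 0"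
        by (rule zero) simp
      ultimately show ?thesis by simp
    qed
    then show "\<forall>i. (\<Prod>j\<in>UNIV. l $ j ^ (E $ i $ j)) = 1"
      using a by (simp add: c_def)
  next
    assume "\<forall>i. (\<Prod>j\<in>UNIV. l $ j ^ (E $ i $ j)) = 1"
    then show "\<forall>x. monomial_sum a E (l * x) = monomial_sum a E x"
      by (simp add: monomial_sum_def power_mult_distrib prod.distrib)
  qed
  then show ?thesis by (simp add: diag_sym_def torus_kernel_def)
qed

lemma carrier_diag_sym_transpose:
  "invertible (real_mat E) \<Longrightarrow> carrier (diag_sym (bh_transpose E)) = torus_kernel (transpose E)"
  unfolding bh_transpose_def by (simp add: carrier_diag_sym invertible_real_mat_transpose)

lemma comm_group_diag_sym: "comm_group (diag_sym f)"
proof (rule comm_groupI)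
  fix l assume "l \<in> carrier (diag_sym f)"
  then have l: "\<And>j. l $ j \<noteq> 0" "\<And>x. f (l * x) = f x" by (auto simp: diag_sym_def)
  let ?k = "(\<chi> j. inverse (l $ j)) :: complex^'a"
  have lk: "l * ?k = 1" "?k * l = 1" using l(1) by (auto simp: vec_eq_iff)
  have "f (?k * x) = f x" for x
    using l(2)[of "?k * x"] lk by (simp add: mult.assoc[symmetric])
  then show "\<exists>k\<in>carrier (diag_sym f). k \<otimes>\<^bsub>diag_sym f\<^esub> l = \<one>\<^bsub>diag_sym f\<^esub>"
    using l lk by (intro bexI[of _ ?k]) (auto simp: diag_sym_def)
qed (auto simp: diag_sym_def mult.assoc intro: mult.commute)

section \<open>The pairing and its nondegeneracy\<close>

lemma pairing_eq_e2pi: "pairing E m l = e2pi (log_vec m \<bullet> (real_mat E *v log_vec l))"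
  by (simp add: pairing_def e2pi_def real_mat_def cis_conv_exp mult_ac)

lemma Ints_inner: "\<lbrakk>\<And>i. x $ i \<in> \<int>; \<And>i. y $ i \<in> \<int>\<rbrakk> \<Longrightarrow> (x :: real^'n) \<bullet> y \<in> \<int>"
  by (auto simp: inner_vec_def intro!: Ints_sum)

lemma inner_real_mat: "u \<bullet> (real_mat E *v v) = (real_mat (transpose E) *v u) \<bullet> v"
  by (simp add: real_mat_transpose dot_lmul_matrix)

text \<open>Any logarithms may replace the principal ones: changing \<open>u\<close> and
  \<open>v\<close> by integer vectors \<open>p\<close> and \<open>q\<close> changes the exponent by
  inner products of integer vectors.\<close>

lemma pairing_e2pi_vec:
  assumes v: "\<And>i. (real_mat E *v v) $ i \<in> \<int>" and u: "\<And>i. (real_mat (transpose E) *v u) $ i \<in> \<int>"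
  shows "pairing E (e2pi_vec u) (e2pi_vec v) = e2pi (u \<bullet> (real_mat E *v v))"
proof -
  have diff: "(log_vec (e2pi_vec w) - w) $ j \<in> \<int>" for w :: "real^'a" and j
  proof -
    have "e2pi_vec (log_vec (e2pi_vec w)) = e2pi_vec w"
      by (rule e2pi_vec_log_vec) (simp add: e2pi_def)
    then have "e2pi (log_vec (e2pi_vec w) $ j) = e2pi (w $ j)"
      by (simp add: vec_eq_iff)
    then show ?thesis by (simp add: e2pi_eq_iff)
  qed
  define p where "p = log_vec (e2pi_vec u) - u"
  define q where "q = log_vec (e2pi_vec v) - v"
  have pq: "p $ j \<in> \<int>" "q $ j \<in> \<int>" for j
    unfolding p_def q_def by (rule diff)+
  have eqs: "log_vec (e2pi_vec u) = u + p" "log_vec (e2pi_vec v) = v + q"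
    by (simp_all add: p_def q_def)
  have Eq: "(real_mat E *v q) $ i \<in> \<int>" for i
    using pq by (auto simp: matrix_vector_mult_def real_mat_def intro!: Ints_sum)
  have "(u + p) \<bullet> (real_mat E *v (v + q)) - u \<bullet> (real_mat E *v v) =
      p \<bullet> (real_mat E *v v) + (real_mat (transpose E) *v u) \<bullet> q + p \<bullet> (real_mat E *v q)"
    unfolding inner_real_mat[of u E q, symmetric]
    by (simp add: matrix_vector_right_distrib inner_add_left inner_add_right)
  also have "\<dots> \<in> \<int>"
    using pq Eq u v by (intro Ints_add Ints_inner)
  finally show ?thesis
    by (simp add: pairing_eq_e2pi eqs e2pi_eq_iff)
qed

text \<open>Exchanging \<open>E\<close> with its transpose swaps the arguments, so results about one
  argument yield those about the other.\<close>

lemma pairing_transpose: "pairing (transpose E) l m = pairing E m l"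
  by (simp add: pairing_eq_e2pi inner_real_mat[of "log_vec m"] inner_commute)

text \<open>Principal logarithms are not additive, but \<open>v + v'\<close> is a logarithm of
  \<open>l * l'\<close>, and \<open>pairing_e2pi_vec\<close> accepts it.\<close>

lemma pairing_mult_right:
  assumes inv: "invertible (real_mat E)" and m: "m \<in> torus_kernel (transpose E)"
    and l: "l \<in> torus_kernel E" "l' \<in> torus_kernel E"
  shows "pairing E m (l * l') = pairing E m l * pairing E m l'"
proof -
  obtain u where u: "m = e2pi_vec u" "\<And>i. (real_mat (transpose E) *v u) $ i \<in> \<int>"
    using m invertible_real_mat_transpose[OF inv] torus_kernel_cases by blast
  obtain v v' where v: "l = e2pi_vec v" "\<And>i. (real_mat E *v v) $ i \<in> \<int>"
      "l' = e2pi_vec v'" "\<And>i. (real_mat E *v v') $ i \<in> \<int>"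
    using l inv torus_kernel_cases by metis
  have "(real_mat E *v (v + v')) $ i \<in> \<int>" for i
    using v by (simp add: matrix_vector_right_distrib)
  then show ?thesis
    using u v by (simp add: pairing_e2pi_vec matrix_vector_right_distrib inner_add_right e2pi_add
        flip: e2pi_vec_add)
qed

text \<open>The columns of the inverse matrix give symmetries whose pairings with \<open>m\<close>
  are exactly the entries of \<open>m\<close>.\<close>

lemma pairing_nondegenerate:
  fixes E :: "nat^'n^'n"
  assumes inv: "invertible (real_mat E)" and m: "m \<in> torus_kernel (transpose E)"
    and triv: "\<And>l. l \<in> torus_kernel E \<Longrightarrow> pairing E m l = 1"
  shows "m = 1"
proof -
  obtain u where u: "m = e2pi_vec u" "\<And>i. (real_mat (transpose E) *v u) $ i \<in> \<int>"
    using m invertible_real_mat_transpose[OF inv] torus_kernel_cases by blast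
  obtain W where W: "\<And>y. real_mat E *v (W *v y) = y" "\<And>x. W *v (real_mat E *v x) = x"
    using real_mat_inverse[OF inv] by (elim exE conjE) auto
  have "e2pi (u $ k) = 1" for k
  proof -
    \<comment> \<open>The \<open>k\<close>-th column of the inverse: \<open>real_mat E\<close> sends
      it to a unit vector, so the exponent of the pairing is \<open>u $ k\<close>.\<close>
    let ?v = "W *v axis k 1"
    have v: "(real_mat E *v ?v) $ i \<in> \<int>" for i
      by (simp add: W axis_def)
    then have "pairing E m (e2pi_vec ?v) = 1"
      using triv by (simp add: e2pi_vec_in_torus_kernel)
    then show ?thesis
      using v u by (simp add: pairing_e2pi_vec W inner_axis)
  qed
  then show ?thesis using u by (simp add: vec_eq_iff)
qed

lemma dual_pair_diag_sym:
  fixes E :: "nat^'n^'n"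
  assumes inv: "invertible (real_mat E)" and a: "\<And>i. a $ i \<noteq> 0"
  shows "dual_pair (diag_sym (monomial_sum a E)) (diag_sym (bh_transpose E)) (pairing E)"
proof -
  let ?A = "diag_sym (monomial_sum a E)" and ?B = "diag_sym (bh_transpose E)"
  interpret A: comm_group ?A by (rule comm_group_diag_sym)
  interpret B: comm_group ?B by (rule comm_group_diag_sym)
  note A = carrier_diag_sym[OF inv a] and B = carrier_diag_sym_transpose[OF inv]
  have ops: "x \<otimes>\<^bsub>?A\<^esub> y = x * y" "m \<otimes>\<^bsub>?B\<^esub> m' = m * m'" "\<one>\<^bsub>?A\<^esub> = 1" "\<one>\<^bsub>?B\<^esub> = 1" for x y m m'
    by (simp_all add: diag_sym_def)
  note inv' = invertible_real_mat_transpose[OF inv]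
  show ?thesis
  proof
    show "finite (carrier ?A)" "finite (carrier ?B)"
      using inv inv' by (simp_all add: A B finite_torus_kernel)
    show "pairing E m x \<noteq> 0" for m x by (simp add: pairing_eq_e2pi)
    fix m x assume m: "m \<in> carrier ?B" and x: "x \<in> carrier ?A"
    show "pairing E m (x \<otimes>\<^bsub>?A\<^esub> y) = pairing E m x * pairing E m y" if "y \<in> carrier ?A" for y
      using m x that inv by (simp only: A B ops pairing_mult_right)
    show "pairing E (m \<otimes>\<^bsub>?B\<^esub> m') x = pairing E m x * pairing E m' x" if "m' \<in> carrier ?B" for m'
      using pairing_mult_right[OF inv', of x m m'] m x that by (simp add: A B ops pairing_transpose)
  next
    fix m assume "m \<in> carrier ?B" "\<And>x. x \<in> carrier ?A \<Longrightarrow> pairing E m x = 1"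
    then show "m = \<one>\<^bsub>?B\<^esub>"
      unfolding A B ops by (rule pairing_nondegenerate[OF inv])
  next
    fix x assume "x \<in> carrier ?A" "\<And>m. m \<in> carrier ?B \<Longrightarrow> pairing E m x = 1"
    then show "x = \<one>\<^bsub>?A\<^esub>"
      unfolding A B ops by (intro pairing_nondegenerate[OF inv', of x]) (simp_all add: pairing_transpose)
  qed
qed

section \<open>Permutations of the variables\<close>

lemma BijGroup_UNIV_mult:
  "\<lbrakk>s \<in> carrier (BijGroup UNIV); t \<in> carrier (BijGroup UNIV)\<rbrakk> \<Longrightarrow> s \<otimes>\<^bsub>BijGroup UNIV\<^esub> t = s \<circ> t"
  by (auto simp: BijGroup_def compose_def)

lemma inv_BijGroup_UNIV:
  "s \<in> carrier (BijGroup UNIV) \<Longrightarrow> inv\<^bsub>BijGroup UNIV\<^esub> s = inv_into UNIV s"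
  using inv_BijGroup[of s UNIV] by (simp add: BijGroup_def restrict_def)

lemma perm_act_comp:
  "\<lbrakk>bij s; bij t\<rbrakk> \<Longrightarrow> perm_act (s \<circ> t) x = perm_act s (perm_act t x)"
  by (simp add: perm_act_def vec_eq_iff o_inv_distrib)

lemma perm_act_mult: "perm_act s (x * y) = perm_act s x * perm_act s y"
  by (simp add: perm_act_def vec_eq_iff)

lemma perm_act_id: "perm_act (\<lambda>x. x) x = x"
  by (simp add: perm_act_def vec_eq_iff flip: id_def)

text \<open>A permuted symmetry is again a symmetry by conjugation: permute back, apply
  \<open>l\<close>, permute again, each step leaving \<open>f\<close> unchanged.\<close>

lemma aut_action_perm_act:
  assumes S: "subgroup S (BijGroup UNIV)" and f: "\<And>s x. s \<in> S \<Longrightarrow> f (perm_act s x) = f x"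
  shows "aut_action (diag_sym f) (BijGroup UNIV\<lparr>carrier := S\<rparr>) perm_act"
proof -
  interpret A: comm_group "diag_sym f" by (rule comm_group_diag_sym)
  interpret H: group "BijGroup UNIV\<lparr>carrier := S\<rparr>"
    using S group.subgroup_imp_group group_BijGroup by blast
  have bij: "bij s" if "s \<in> S" for s
    using subgroup.mem_carrier[OF S that] by (simp add: BijGroup_def Bij_def)
  have inv_S: "inv_into UNIV s \<in> S" if "s \<in> S" for s
    using subgroup.m_inv_closed[OF S that] subgroup.mem_carrier[OF S that]
    by (simp add: inv_BijGroup_UNIV)
  have closed: "perm_act s l \<in> carrier (diag_sym f)" if s: "s \<in> S" and l: "l \<in> carrier (diag_sym f)" for s l
  proof -
    have "f (perm_act s l * x) = f x" for x
    proof -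
      have "perm_act s (perm_act (inv_into UNIV s) x) = perm_act (s \<circ> inv_into UNIV s) x"
        using bij[OF s] by (simp add: perm_act_comp bij_imp_bij_inv)
      also have "s \<circ> inv_into UNIV s = (\<lambda>x. x)"
        using bij[OF s] by (auto simp: fun_eq_iff bij_is_surj surj_f_inv_f)
      finally have x: "perm_act s (perm_act (inv_into UNIV s) x) = x" by (simp add: perm_act_id)
      have "f (perm_act s l * x) = f (perm_act s (l * perm_act (inv_into UNIV s) x))"
        by (simp add: perm_act_mult x)
      also have "\<dots> = f x"
        using f[OF s] f[OF inv_S[OF s]] l by (simp add: diag_sym_def)
      finally show ?thesis .
    qed
    then show ?thesis using l by (simp add: diag_sym_def perm_act_def)
  qed
  show ?thesis
  proof
    show "perm_act s \<in> hom (diag_sym f) (diag_sym f)" if "s \<in> carrier (BijGroup UNIV\<lparr>carrier := S\<rparr>)" for s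
      using that closed by (auto simp: hom_def) (simp add: diag_sym_def perm_act_mult)
    show "perm_act (s \<otimes>\<^bsub>BijGroup UNIV\<lparr>carrier := S\<rparr>\<^esub> t) x = perm_act s (perm_act t x)"
      if "s \<in> carrier (BijGroup UNIV\<lparr>carrier := S\<rparr>)" "t \<in> carrier (BijGroup UNIV\<lparr>carrier := S\<rparr>)" for s t x
      using that bij subgroup.mem_carrier[OF S] by (simp add: BijGroup_UNIV_mult perm_act_comp)
    show "perm_act \<one>\<^bsub>BijGroup UNIV\<lparr>carrier := S\<rparr>\<^esub> x = x" for x
      by (simp add: BijGroup_def restrict_def perm_act_id)
  qed
qed

theorem theorem3:
  fixes a :: "complex^'n" and E :: "nat^'n^'n"
    and S T :: "('n \<Rightarrow> 'n) set" and G :: "(complex^'n) set"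
  assumes "invertible_poly a E"
    and "subgroup S (BijGroup UNIV)"
    and "\<forall>s\<in>S. \<forall>x. monomial_sum a E (perm_act s x) = monomial_sum a E x"
    and "subgroup G (diag_sym (monomial_sum a E))"
    and "\<forall>s\<in>S. perm_act s ` G \<subseteq> G"
    and "subgroup T (BijGroup UNIV\<lparr>carrier := S\<rparr>)"
  shows "let K = symm_semidirect a E S; K' = dual_symm_semidirect a E S in
         orbifold_euler (lcosets\<^bsub>K\<^esub> ({1} \<times> T))
           (K\<lparr>carrier := G \<times> S\<rparr>) (\<lambda>g C. g <#\<^bsub>K\<^esub> C) =
         orbifold_euler (lcosets\<^bsub>K'\<^esub> (carrier (diag_sym (bh_transpose E)) \<times> T))
           (K'\<lparr>carrier := dual_subgroup E G \<times> S\<rparr>) (\<lambda>g C. g <#\<^bsub>K'\<^esub> C)"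
proof -
  let ?A = "diag_sym (monomial_sum a E)" and ?B = "diag_sym (bh_transpose E)"
  let ?H = "BijGroup UNIV\<lparr>carrier := S\<rparr>"
  have inv: "invertible (real_mat E)" and a: "\<And>i. a $ i \<noteq> 0"
    using assms(1) by (simp_all add: invertible_poly_def invertible_real_mat)
  interpret dual_pair ?A ?B "pairing E"
    using inv a by (rule dual_pair_diag_sym)
  interpret act: aut_action ?A ?H perm_act
    using assms(2,3) by (intro aut_action_perm_act) auto
  have inv_H: "inv\<^bsub>?H\<^esub> s = inv_into UNIV s" if "s \<in> S" for s
    using subgroup.mem_carrier[OF assms(2) that]
    by (simp add: group.m_inv_consistent[OF group_BijGroup assms(2) that] inv_BijGroup_UNIV)
  \<comment> \<open>The definite description is justified here: composing the character of
    \<open>m\<close> with the inverse permutation gives a character of \<open>?A\<close>,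
    represented by \<open>character_representable\<close> and unique by
    \<open>P_left_inject\<close>.\<close>
  have dual: "dual_act a E s m \<in> carrier ?B \<and>
      (\<forall>g\<in>carrier ?A. pairing E (dual_act a E s m) g = pairing E m (perm_act (inv_into UNIV s) g))"
    if s: "s \<in> S" and m: "m \<in> carrier ?B" for s m
    unfolding dual_act_def
  proof (rule theI')
    have closed: "perm_act (inv_into UNIV s) g \<in> carrier ?A" if "g \<in> carrier ?A" for g
      using act.act_closed[of "inv\<^bsub>?H\<^esub> s" g] act.H.inv_closed[of s] s that by (simp add: inv_H)
    have "\<exists>m'\<in>carrier ?B. \<forall>g\<in>carrier ?A. pairing E m' g = pairing E m (perm_act (inv_into UNIV s) g)"
    proof (rule character_representable)
      show "pairing E m (perm_act (inv_into UNIV s) (x \<otimes>\<^bsub>?A\<^esub> y)) =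
          pairing E m (perm_act (inv_into UNIV s) x) * pairing E m (perm_act (inv_into UNIV s) y)"
        if "x \<in> carrier ?A" "y \<in> carrier ?A" for x y
        using act.act_hom_mult[of "inv\<^bsub>?H\<^esub> s" x y] act.H.inv_closed[of s] s m that closed
        by (simp add: inv_H P_mult_right)
    qed (use m closed P_nonzero in blast)
    then show "\<exists>!m'. m' \<in> carrier ?B \<and> (\<forall>g\<in>carrier ?A. pairing E m' g = pairing E m (perm_act (inv_into UNIV s) g))"
      by (auto intro: P_left_inject)
  qed
  \<comment> \<open>The property just extracted from the description is the adjointness axiom, once
    inverses in \<open>?H\<close> are read as inverse functions.\<close>
  interpret dual_actions ?A ?B "pairing E" ?H perm_act "dual_act a E"
    by unfold_locales (use dual inv_H in auto)
  have "orbifold_euler (lcosets\<^bsub>semidirect ?A ?H perm_act\<^esub> ({\<one>\<^bsub>?A\<^esub>} \<times> T))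
      ((semidirect ?A ?H perm_act)\<lparr>carrier := G \<times> carrier ?H\<rparr>) (\<lambda>g C. g <#\<^bsub>semidirect ?A ?H perm_act\<^esub> C) =
    orbifold_euler (lcosets\<^bsub>semidirect ?B ?H (dual_act a E)\<^esub> (carrier ?B \<times> T))
      ((semidirect ?B ?H (dual_act a E))\<lparr>carrier := ann G \<times> carrier ?H\<rparr>)
      (\<lambda>g C. g <#\<^bsub>semidirect ?B ?H (dual_act a E)\<^esub> C)"
    using assms(4-6) by (intro orbifold_euler_dual) auto
  moreover have "ann G = dual_subgroup E G"
    by (simp add: ann_def dual_subgroup_def)
  moreover have "\<one>\<^bsub>?A\<^esub> = 1"
    by (simp add: diag_sym_def)
  ultimately show ?thesis
    by (simp add: Let_def symm_semidirect_def dual_symm_semidirect_def)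
qed

end
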